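(* Let $D$ and $D'$ be domains in $\mathbb{R}^n$, $n\geqslant 2$, and let $D$ have a weakly flat boundary. Let $Q:\mathbb{R}^n\to[0,\infty]$ be Lebesgue measurable with $Q\in L^1(D')$, and let $f$ be an open discrete mapping of $D$ onto $D'$ which satisfies the inverse Poletsky inequality with majorant $Q$ at each point $y_0\in\overline{D'}\setminus\{\infty\}$. Assume that: (i) $C(f,\partial D)\subset E$ for some set $E\subset\overline{D'}$ which is closed in $\overline{\mathbb{R}^n}$, and $D'$ is locally finitely connected with respect to $E$, i.e. for each point $z_0\in E$ and any neighborhood $U$ of $z_0$ there exists a neighborhood $V\subset U$ of $z_0$ such that $V\cap(D'\setminus E)$ consists of a finite number of components; (ii) the set $f^{-1}(E\cap D')$ is nowhere dense in $D$. Then $f$ has a continuous extension $\overline{f}:\overline{D}\to\overline{D'}$, and moreover $\overline{f}(\overline{D})=\overline{D'}$.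
   Context: Mappings are continuous. $\overline{\mathbb{R}^n}=\mathbb{R}^n\cup\{\infty\}$ carries the chordal metric $h(x,\infty)=\frac{1}{\sqrt{1+|x|^2}}$, $h(x,y)=\frac{|x-y|}{\sqrt{1+|x|^2}\sqrt{1+|y|^2}}$ for $x\neq\infty\neq y$. Closures $\overline{A}$, boundaries $\partial A$, neighborhoods and continuity of the extension are understood in $(\overline{\mathbb{R}^n},h)$. A set $U$ is a neighborhood of $z_0$ if $z_0\in\mathrm{Int}\,U$ (it need not be open). A mapping $f:D\to\mathbb{R}^n$ is discrete if $f^{-1}(y)$ consists of isolated points for each $y\in\mathbb{R}^n$, and open if images of open subsets of $D$ are open in $\mathbb{R}^n$. The cluster sets are $C(f,x)=\{y\in\overline{\mathbb{R}^n}:\exists\,x_k\in D,\ x_k\to x,\ f(x_k)\to y\}$ and $C(f,\partial D)=\bigcup_{x\in\partial D}C(f,x)$. Let $m$ denote Lebesgue measure in $\mathbb{R}^n$. For a path family $\Gamma$, $M(\Gamma)=\inf\int_{\mathbb{R}^n}\rho^n\,dm$, the infimum over Borel functions $\rho:\mathbb{R}^n\to[0,\infty]$ with $\int_\gamma\rho\,|dx|\geqslant1$ for every locally rectifiable $\gamma\in\Gamma$. For sets $E,F\subset\overline{\mathbb{R}^n}$, $\Gamma(E,F,D)$ is the family of all paths $\gamma:[a,b]\to\overline{\mathbb{R}^n}$ with $\gamma(a)\in E$, $\gamma(b)\in F$, $\gamma(t)\in D$ for $t\in(a,b)$. Put $S(y_0,r)=\{y\in\mathbb{R}^n:|y-y_0|=r\}$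 and $A(y_0,r_1,r_2)=\{y\in\mathbb{R}^n:r_1<|y-y_0|<r_2\}$. For $f:D\to\mathbb{R}^n$, $y_0\in\overline{f(D)}\setminus\{\infty\}$ and $0<r_1<r_2<d_0=\sup_{y\in f(D)}|y-y_0|$, $\Gamma_f(y_0,r_1,r_2)$ is the family of all paths $\gamma$ in $D$ such that $f(\gamma)\in\Gamma(S(y_0,r_1),S(y_0,r_2),A(y_0,r_1,r_2))$. We say that $f$ satisfies the inverse Poletsky inequality with majorant $Q$ at $y_0$ if for all such $r_1,r_2$ $$M(\Gamma_f(y_0,r_1,r_2))\leqslant\int_{A(y_0,r_1,r_2)\cap f(D)}Q(y)\,\eta^n(|y-y_0|)\,dm(y)$$ for every Lebesgue measurable $\eta:(r_1,r_2)\to[0,\infty]$ with $\int_{r_1}^{r_2}\eta(r)\,dr\geqslant1$. The boundary of $D$ is weakly flat at $x_0\in\partial D$ if for every $P>0$ and every neighborhood $U$ of $x_0$ there is a neighborhood $V\subset U$ of $x_0$ such that $M(\Gamma(E,F,D))>P$ for any continua $E,F\subset D$ with $E\cap\partial U\neq\varnothing\neq E\cap\partial V$ and $F\cap\partial U\neq\varnothing\neq F\cap\partial V$. The boundary of $D$ is weakly flat if it is so at each of its points. *)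

theory Defs
  imports "HOL-Analysis.Analysis"
begin

section \<open>The extended space with the chordal metric\<close>

datatype 'a ext = Fin 'a | Infty

fun chordal :: "'a::real_normed_vector ext \<Rightarrow> 'a ext \<Rightarrow> real" where
  "chordal (Fin x) (Fin y) =
     norm (x - y) / (sqrt (1 + (norm x)\<^sup>2) * sqrt (1 + (norm y)\<^sup>2))"
| "chordal (Fin x) Infty = 1 / sqrt (1 + (norm x)\<^sup>2)"
| "chordal Infty (Fin y) = 1 / sqrt (1 + (norm y)\<^sup>2)"
| "chordal Infty Infty = 0"

text \<open>Stereographic projection onto the sphere of radius 1/2 with south pole 0; it is an
  isometry for the chordal metric and is used only to derive the metric axioms.\<close>

fun stereo :: "'a::real_inner ext \<Rightarrow> 'a \<times> real" where
  "stereo (Fin x) = (x /\<^sub>R (1 + (norm x)\<^sup>2), (norm x)\<^sup>2 / (1 + (norm x)\<^sup>2))"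
| "stereo Infty = (0, 1)"

lemma one_plus_norm_sq_pos: "0 < 1 + (norm x)\<^sup>2"
  by (simp add: add_pos_nonneg)

lemma chordal_eq_dist_stereo: "chordal p q = dist (stereo p) (stereo q)"
proof -
  have inf: "chordal (Fin x) Infty = dist (stereo (Fin x)) (stereo Infty)" for x :: 'a
  proof -
    define a where "a = (norm x)\<^sup>2"
    have a: "0 < 1 + a" "a \<ge> 0"
      using one_plus_norm_sq_pos[of x] by (auto simp: a_def)
    have e1: "(dist (x /\<^sub>R (1 + a)) 0)\<^sup>2 = a / (1 + a)\<^sup>2"
      using a by (simp add: power_mult_distrib a_def divide_inverse power_inverse mult.commute)
    have e2: "(dist (a / (1 + a)) 1)\<^sup>2 = 1 / (1 + a)\<^sup>2"
    proof -
      have "a / (1 + a) - 1 = - (1 / (1 + a))"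
        using a by (simp add: field_simps)
      then show ?thesis by (simp add: dist_real_def power_divide)
    qed
    have "a / (1 + a)\<^sup>2 + 1 / (1 + a)\<^sup>2 = 1 / (1 + a)"
      using a by (simp add: power2_eq_square flip: add_divide_distrib)
        (simp add: add.commute)
    then have "dist (stereo (Fin x)) (stereo Infty) = sqrt (1 / (1 + a))"
      using e1 e2 by (simp add: dist_prod_def a_def)
    then show ?thesis by (simp add: a_def real_sqrt_divide)
  qed
  have fin: "chordal (Fin x) (Fin y) = dist (stereo (Fin x)) (stereo (Fin y))" for x y :: 'a
  proof -
    define a b c where "a = (norm x)\<^sup>2" and "b = (norm y)\<^sup>2" and "c = x \<bullet> y"
    have a: "0 < 1 + a" and b: "0 < 1 + b"
      using one_plus_norm_sq_pos[of x] one_plus_norm_sq_pos[of y] by (auto simp: a_def b_def)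
    have n: "(norm (s *\<^sub>R x - t *\<^sub>R y))\<^sup>2 = s\<^sup>2 * a + t\<^sup>2 * b - 2 * s * t * c" for s t
      unfolding a_def b_def c_def power2_norm_eq_inner inner_diff_left inner_diff_right
        inner_scaleR_left inner_scaleR_right inner_commute[of y x]
      by algebra
    have e1: "(dist (x /\<^sub>R (1 + a)) (y /\<^sub>R (1 + b)))\<^sup>2
        = a / (1 + a)\<^sup>2 + b / (1 + b)\<^sup>2 - 2 * c / ((1 + a) * (1 + b))"
      using n[of "inverse (1 + a)" "inverse (1 + b)"]
      by (simp add: dist_norm divide_inverse power_inverse mult_ac)
    have e2: "(dist (a / (1 + a)) (b / (1 + b)))\<^sup>2 = (a / (1 + a) - b / (1 + b))\<^sup>2"
      by (simp add: dist_real_def)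
    have e3: "(norm (x - y))\<^sup>2 = a + b - 2 * c"
      using n[of 1 1] by simp
    have "a / (1 + a)\<^sup>2 + b / (1 + b)\<^sup>2 - 2 * c / ((1 + a) * (1 + b))
        + (a / (1 + a) - b / (1 + b))\<^sup>2 = (a + b - 2 * c) / ((1 + a) * (1 + b))"
    proof -
      define u v where "u = 1 + a" and "v = 1 + b"
      have uv: "u \<noteq> 0" "v \<noteq> 0" "a = u - 1" "b = v - 1"
        using a b by (auto simp: u_def v_def)
      have "(u - 1) / u\<^sup>2 + (v - 1) / v\<^sup>2 - 2 * c / (u * v) + ((u - 1) / u - (v - 1) / v)\<^sup>2
        = (u - 1 + (v - 1) - 2 * c) / (u * v)"
        using uv(1,2) by (simp add: divide_simps power2_eq_square) algebra
      then show ?thesis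
        unfolding uv(3,4) by simp
    qed
    then have "dist (stereo (Fin x)) (stereo (Fin y)) = sqrt ((norm (x - y))\<^sup>2 / ((1 + a) * (1 + b)))"
      using e1 e2 e3 by (simp add: dist_prod_def a_def b_def)
    then show ?thesis
      by (simp add: a_def b_def real_sqrt_divide real_sqrt_mult)
  qed
  show ?thesis
  proof (cases p; cases q)
    fix y assume "p = Infty" "q = Fin y"
    then show ?thesis using inf[of y] by (simp add: dist_commute)
  qed (use inf fin in auto)
qed

lemma inj_stereo: "stereo p = stereo q \<Longrightarrow> p = q"
proof -
  assume "stereo p = stereo q"
  then have "chordal p q = 0" by (simp add: chordal_eq_dist_stereo)
  moreover have "1 + (norm x)\<^sup>2 \<noteq> 0" for x :: 'a
    using one_plus_norm_sq_pos[of x] by simp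
  ultimately show "p = q" by (cases p; cases q) auto
qed

instantiation ext :: (real_inner) metric_space
begin

definition dist_ext :: "'a ext \<Rightarrow> 'a ext \<Rightarrow> real" where
  "dist_ext = chordal"

definition uniformity_ext :: "('a ext \<times> 'a ext) filter" where
  "uniformity_ext = (INF e\<in>{0 <..}. principal {(x, y). dist x y < e})"

definition open_ext :: "'a ext set \<Rightarrow> bool" where
  "open_ext U \<longleftrightarrow> (\<forall>x\<in>U. eventually (\<lambda>(x', y). x' = x \<longrightarrow> y \<in> U) uniformity)"

instance
proof
  fix x y z :: "'a ext"
  show "dist x y = 0 \<longleftrightarrow> x = y"
    using inj_stereo by (auto simp: dist_ext_def chordal_eq_dist_stereo)
  show "dist x y \<le> dist x z + dist y z"
    by (simp add: dist_ext_def chordal_eq_dist_stereo dist_triangle2)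
qed (simp_all only: uniformity_ext_def open_ext_def)

end

text \<open>From here on \<open>closure\<close>, \<open>interior\<close>, \<open>frontier\<close> and limits on type \<open>'a ext\<close> are those
  of the chordal metric; \<open>Fin ` A\<close> is a subset \<open>A\<close> of the finite space viewed there.
  Neighbourhoods need not be open.\<close>

definition nbhd :: "'b::topological_space \<Rightarrow> 'b set \<Rightarrow> bool" where
  "nbhd z U \<longleftrightarrow> z \<in> interior U"

definition domain :: "'a::topological_space set \<Rightarrow> bool" where
  "domain D \<longleftrightarrow> open D \<and> connected D \<and> D \<noteq> {}"

definition continuum :: "'a::topological_space set \<Rightarrow> bool" where
  "continuum K \<longleftrightarrow> compact K \<and> connected K \<and> K \<noteq> {}"


section \<open>Path families and their modulus\<close>

text \<open>The triple \<open>(a, b, \<gamma>)\<close> stands for a path \<open>\<gamma>\<close> on \<open>[a, b]\<close>; values of \<open>\<gamma>\<close> outside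
  \<open>[a, b]\<close> play no role.\<close>

type_synonym 'a curve = "real \<times> real \<times> (real \<Rightarrow> 'a)"

definition is_curve :: "'a::topological_space curve \<Rightarrow> bool" where
  "is_curve = (\<lambda>(a, b, \<gamma>). a < b \<and> continuous_on {a..b} \<gamma>)"

definition curve_length :: "'a::metric_space curve \<Rightarrow> ennreal" where
  "curve_length = (\<lambda>(a, b, \<gamma>).
     SUP ts \<in> {ts. sorted ts \<and> set ts \<subseteq> {a..b}}.
       \<Sum>i<length ts - 1. ennreal (dist (\<gamma> (ts ! i)) (\<gamma> (ts ! Suc i))))"

definition locally_rectifiable :: "'a::metric_space curve \<Rightarrow> bool" where
  "locally_rectifiable = (\<lambda>(a, b, \<gamma>).
     \<forall>c d. a \<le> c \<and> c \<le> d \<and> d \<le> b \<longrightarrow> curve_length (c, d, \<gamma>) < \<infinity>)"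

text \<open>The parametrization by arc length.  If \<open>(a, b, \<gamma>)\<close> is a rectifiable path, its length
  function is continuous on \<open>[a, b]\<close>, so for \<open>s\<close> between 0 and the total length a
  parameter \<open>t\<close> as below exists; \<open>\<gamma>\<close> is constant on the set of all such \<open>t\<close>, so the choice
  is immaterial.\<close>

definition arc_length_param :: "'a::metric_space curve \<Rightarrow> real \<Rightarrow> 'a" where
  "arc_length_param = (\<lambda>(a, b, \<gamma>) s.
     \<gamma> (SOME t. t \<in> {a..b} \<and> curve_length (a, t, \<gamma>) = ennreal s))"

text \<open>Meaningful only for rectifiable paths.\<close>

definition line_integral :: "('a::metric_space \<Rightarrow> ennreal) \<Rightarrow> 'a curve \<Rightarrow> ennreal" where
  "line_integral \<rho> c =
     (\<integral>\<^sup>+ s \<in> {0..enn2real (curve_length c)}. \<rho> (arc_length_param c s) \<partial>lborel)"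

definition admissible :: "('a::euclidean_space \<Rightarrow> ennreal) \<Rightarrow> 'a curve set \<Rightarrow> bool" where
  "admissible \<rho> \<Gamma> \<longleftrightarrow>
     \<rho> \<in> borel_measurable borel \<and> (\<forall>c\<in>\<Gamma>. locally_rectifiable c \<longrightarrow> 1 \<le> line_integral \<rho> c)"

definition modulus :: "'a::euclidean_space curve set \<Rightarrow> ennreal" where
  "modulus \<Gamma> = (INF \<rho> \<in> {\<rho>. admissible \<rho> \<Gamma>}. \<integral>\<^sup>+ x. \<rho> x ^ DIM('a) \<partial>lebesgue)"

text \<open>The family \<open>\<Gamma>(E, F, D)\<close>, in any ambient space.  Below it is only needed when
  \<open>E\<close>, \<open>F\<close>, \<open>D\<close> lie in the finite space; its members then avoid \<open>\<infinity>\<close>, so the finite space is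
  taken as the ambient one.\<close>

definition connecting_curves ::
  "'b::topological_space set \<Rightarrow> 'b set \<Rightarrow> 'b set \<Rightarrow> 'b curve set" where
  "connecting_curves E F D =
     {(a, b, \<gamma>). is_curve (a, b, \<gamma>) \<and> \<gamma> a \<in> E \<and> \<gamma> b \<in> F \<and> (\<forall>t\<in>{a<..<b}. \<gamma> t \<in> D)}"

definition annulus :: "'a::metric_space \<Rightarrow> real \<Rightarrow> real \<Rightarrow> 'a set" where
  "annulus y r1 r2 = {x. r1 < dist x y \<and> dist x y < r2}"

definition lifted_curves ::
  "('a::euclidean_space \<Rightarrow> 'a) \<Rightarrow> 'a set \<Rightarrow> 'a \<Rightarrow> real \<Rightarrow> real \<Rightarrow> 'a curve set" where
  "lifted_curves f D y0 r1 r2 =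
     {(a, b, \<gamma>). is_curve (a, b, \<gamma>) \<and> \<gamma> ` {a..b} \<subseteq> D \<and>
        (a, b, f \<circ> \<gamma>) \<in> connecting_curves (sphere y0 r1) (sphere y0 r2) (annulus y0 r1 r2)}"


section \<open>Mappings and boundaries\<close>

definition inverse_poletsky ::
  "('a::euclidean_space \<Rightarrow> 'a) \<Rightarrow> 'a set \<Rightarrow> ('a \<Rightarrow> ennreal) \<Rightarrow> 'a \<Rightarrow> bool" where
  "inverse_poletsky f D Q y0 \<longleftrightarrow>
     (\<forall>r1 r2. 0 < r1 \<and> r1 < r2 \<and> ereal r2 < (SUP y\<in>f ` D. ereal (dist y y0)) \<longrightarrow>
       (\<forall>\<eta> :: real \<Rightarrow> ennreal.
          \<eta> \<in> borel_measurable (lebesgue_on {r1<..<r2}) \<and>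
          1 \<le> (\<integral>\<^sup>+ r \<in> {r1<..<r2}. \<eta> r \<partial>lebesgue) \<longrightarrow>
          modulus (lifted_curves f D y0 r1 r2)
            \<le> (\<integral>\<^sup>+ y \<in> annulus y0 r1 r2 \<inter> f ` D. Q y * \<eta> (dist y y0) ^ DIM('a) \<partial>lebesgue)))"

definition discrete_map_on :: "'a::topological_space set \<Rightarrow> ('a \<Rightarrow> 'b) \<Rightarrow> bool" where
  "discrete_map_on D f \<longleftrightarrow> (\<forall>y. discrete {x \<in> D. f x = y})"

definition open_map_on ::
  "'a::topological_space set \<Rightarrow> ('a \<Rightarrow> 'b::topological_space) \<Rightarrow> bool" where
  "open_map_on D f \<longleftrightarrow> (\<forall>U. open U \<and> U \<subseteq> D \<longrightarrow> open (f ` U))"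

definition cluster_set ::
  "('a::real_inner \<Rightarrow> 'a) \<Rightarrow> 'a set \<Rightarrow> 'a ext \<Rightarrow> 'a ext set" where
  "cluster_set f D x =
     {y. \<exists>u. (\<forall>k. u k \<in> D) \<and> (\<lambda>k. Fin (u k)) \<longlonglongrightarrow> x \<and> (\<lambda>k. Fin (f (u k))) \<longlonglongrightarrow> y}"

definition boundary_cluster_set :: "('a::real_inner \<Rightarrow> 'a) \<Rightarrow> 'a set \<Rightarrow> 'a ext set" where
  "boundary_cluster_set f D = (\<Union>x\<in>frontier (Fin ` D). cluster_set f D x)"

definition weakly_flat_at :: "'a::euclidean_space set \<Rightarrow> 'a ext \<Rightarrow> bool" where
  "weakly_flat_at D x0 \<longleftrightarrow>
     (\<forall>P>0. \<forall>U. nbhd x0 U \<longrightarrow>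
       (\<exists>V\<subseteq>U. nbhd x0 V \<and>
         (\<forall>E F. continuum E \<and> continuum F \<and> E \<subseteq> D \<and> F \<subseteq> D \<and>
            Fin ` E \<inter> frontier U \<noteq> {} \<and> Fin ` E \<inter> frontier V \<noteq> {} \<and>
            Fin ` F \<inter> frontier U \<noteq> {} \<and> Fin ` F \<inter> frontier V \<noteq> {} \<longrightarrow>
            ennreal P < modulus (connecting_curves E F D))))"

definition weakly_flat_boundary :: "'a::euclidean_space set \<Rightarrow> bool" where
  "weakly_flat_boundary D \<longleftrightarrow> (\<forall>x0\<in>frontier (Fin ` D). weakly_flat_at D x0)"

definition locally_finitely_connected_wrt :: "'a::real_inner set \<Rightarrow> 'a ext set \<Rightarrow> bool" where
  "locally_finitely_connected_wrt D E \<longleftrightarrow>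
     (\<forall>z0\<in>E. \<forall>U. nbhd z0 U \<longrightarrow>
       (\<exists>V\<subseteq>U. nbhd z0 V \<and> finite (components (V \<inter> (Fin ` D - E)))))"

definition nowhere_dense_in :: "'a::topological_space set \<Rightarrow> 'a set \<Rightarrow> bool" where
  "nowhere_dense_in D A \<longleftrightarrow>
     (top_of_set D) interior_of ((top_of_set D) closure_of A) = {}"

end

theory Submission
  imports Defs
begin

text \<open>
  If two sequences tending to the same boundary point \<open>x\<^sub>0\<close> had images with different limits
  \<open>z\<^sub>1 \<noteq> z\<^sub>2\<close>, say with \<open>z\<^sub>1\<close> finite, both sequences may be moved off \<open>f\<^sup>-\<^sup>1(E)\<close> by (ii), and by (i)
  infinitely many of the image points lie in one component of \<open>D' - E\<close> near \<open>z\<^sub>1\<close>, respectively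
  \<open>z\<^sub>2\<close>.  Over \<open>D' - E\<close> the map \<open>f\<close> is proper, because its boundary cluster values lie in \<open>E\<close>; so a
  path in such a component joining two of the image points lifts to a continuum that starts at a
  term of the sequence and ends in a fixed compact subset of \<open>D\<close>.  Weak flatness makes the modulus
  of the paths joining the two resulting continua arbitrarily large, while the inverse Poletsky
  inequality at \<open>z\<^sub>1\<close> with constant \<open>\<eta>\<close> bounds it.  By compactness of the extended space, \<open>f\<close> is then
  uniformly continuous for the chordal metric, hence extends to the closure.
\<close>

subsection \<open>The chordal compactification\<close>

text \<open>Inverse stereographic projection in the coordinates of \<open>stereo\<close>, which
  makes continuity on the finite part visible. At \<open>Infty\<close> the division by zero gives
  the default value 0.\<close>

definition ext_fin :: "'a::real_inner ext \<Rightarrow> 'a" where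
  "ext_fin p = fst (stereo p) /\<^sub>R (1 - snd (stereo p))"

lemma one_minus_snd_stereo_Fin: "1 - snd (stereo (Fin x)) = 1 / (1 + (norm x)\<^sup>2)"
  using one_plus_norm_sq_pos[of x] by (simp add: field_simps)

lemma ext_fin_Fin [simp]: "ext_fin (Fin x) = x"
  using one_plus_norm_sq_pos[of x]
  unfolding ext_fin_def one_minus_snd_stereo_Fin by simp

lemma dist_stereo: "dist (stereo p) (stereo q) = dist p q"
  by (simp add: dist_ext_def chordal_eq_dist_stereo)

lemma continuous_on_stereo: "continuous_on S stereo"
  unfolding continuous_on_iff dist_stereo by blast

lemma ext_neq_Infty_iff: "p \<noteq> Infty \<longleftrightarrow> p \<in> range Fin"
  by (cases p) auto

lemma continuous_on_ext_fin: "continuous_on (range Fin) ext_fin"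
  unfolding ext_fin_def
proof (intro continuous_intros continuous_on_stereo ballI)
  fix p :: "'a ext" assume "p \<in> range Fin"
  then obtain x where "p = Fin x" by auto
  then show "1 - snd (stereo p) \<noteq> 0"
    using one_minus_snd_stereo_Fin[of x] one_plus_norm_sq_pos[of x] by simp
qed

lemma dist_Fin_le: "dist (Fin x) (Fin y) \<le> dist x y"
proof -
  have "1 \<le> sqrt (1 + (norm x)\<^sup>2) * sqrt (1 + (norm y)\<^sup>2)"
    using mult_mono[of 1 "sqrt (1 + (norm x)\<^sup>2)" 1 "sqrt (1 + (norm y)\<^sup>2)"] by simp
  then show ?thesis
    using mult_left_mono[of 1 _ "norm (x - y)"]
    by (simp add: dist_ext_def dist_norm divide_le_eq)
qed

lemma continuous_on_Fin: "continuous_on S Fin"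
  unfolding continuous_on_iff using dist_Fin_le order_le_less_trans by blast

lemma open_range_Fin: "open (range Fin :: 'a::real_inner ext set)"
proof -
  have "range Fin = - {Infty :: 'a ext}"
    using ext_neq_Infty_iff by blast
  then show ?thesis by (simp add: open_Compl)
qed

text \<open>The chordal metric induces the Euclidean topology on the finite part: \<open>Fin\<close>
  is 1-Lipschitz and \<open>ext_fin\<close> is its continuous inverse there.\<close>

lemma tendsto_Fin_iff: "((\<lambda>k. Fin (u k)) \<longlongrightarrow> Fin x) F \<longleftrightarrow> (u \<longlongrightarrow> x) F"
proof
  assume "((\<lambda>k. Fin (u k)) \<longlongrightarrow> Fin x) F"
  moreover have "isCont ext_fin (Fin x)"
    using continuous_on_ext_fin continuous_on_eq_continuous_at[OF open_range_Fin] by blast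
  ultimately show "(u \<longlongrightarrow> x) F"
    using isCont_tendsto_compose by fastforce
next
  assume "(u \<longlongrightarrow> x) F"
  then show "((\<lambda>k. Fin (u k)) \<longlongrightarrow> Fin x) F"
    using continuous_on_Fin[of UNIV] continuous_on_eq_continuous_at isCont_tendsto_compose
    by blast
qed

lemma open_Fin_image: "open A \<Longrightarrow> open (Fin ` A)"
proof -
  assume "open A"
  then have "open (range Fin \<inter> ext_fin -` A)"
    using continuous_on_ext_fin open_range_Fin continuous_open_preimage by blast
  moreover have "range Fin \<inter> ext_fin -` A = Fin ` A" by auto
  ultimately show ?thesis by simp
qed

section \<open>Compactness and completeness of the extended space\<close>

text \<open>The equation is that of the sphere of radius 1/2 centred at \<open>(0, 1/2)\<close>;
  every point except the pole \<open>(0, 1)\<close> comes from the finite point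
  \<open>v /\<^sub>R (1 - t)\<close>.\<close>

lemma stereo_surj_sphere:
  fixes v :: "'a::real_inner"
  assumes "(norm v)\<^sup>2 = t * (1 - t)"
  shows "(v, t) \<in> range stereo"
proof (cases "t = 1")
  case True
  then have "(v, t) = stereo Infty" using assms by simp
  then show ?thesis by blast
next
  case False
  have "0 \<le> t * (1 - t)" using assms zero_le_power2[of "norm v"] by simp
  with False have t: "t < 1" by (auto simp: zero_le_mult_iff)
  define x where "x = v /\<^sub>R (1 - t)"
  have "(norm x)\<^sup>2 = (norm v)\<^sup>2 / (1 - t)\<^sup>2"
    using t by (simp add: x_def power_mult_distrib divide_simps)
  also have "\<dots> = t / (1 - t)"
    using t unfolding assms by (simp add: power2_eq_square)
  finally have n: "(norm x)\<^sup>2 = t / (1 - t)" .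
  then have "1 + (norm x)\<^sup>2 = 1 / (1 - t)" using t by (simp add: field_simps)
  then have "stereo (Fin x) = (v, t)" using t n by (simp add: x_def)
  then show ?thesis by (metis rangeI)
qed

lemma norm_fst_stereo: "(norm (fst (stereo p)))\<^sup>2 = snd (stereo p) * (1 - snd (stereo p))"
proof (cases p)
  case (Fin x)
  show ?thesis
    using one_plus_norm_sq_pos[of x] unfolding Fin one_minus_snd_stereo_Fin
    by (simp add: power_mult_distrib power2_eq_square divide_simps)
qed simp

text \<open>\<open>stereo\<close> is an isometry onto a closed bounded subset of a
  finite-dimensional space, so its inverse carries compactness back.\<close>

lemma compact_UNIV_ext: "compact (UNIV :: 'a::euclidean_space ext set)"
proof -
  let ?S = "range (stereo :: 'a ext \<Rightarrow> _)"
  have S: "?S = {(v, t). (norm v)\<^sup>2 = t * (1 - t)}"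
  proof (intro set_eqI iffI)
    fix q :: "'a \<times> real" assume "q \<in> ?S"
    then obtain p where "q = stereo p" by blast
    then show "q \<in> {(v, t). (norm v)\<^sup>2 = t * (1 - t)}"
      using norm_fst_stereo[of p] by (cases q) (simp add: prod_eq_iff case_prod_beta del: stereo.simps)
  next
    fix q :: "'a \<times> real" assume "q \<in> {(v, t). (norm v)\<^sup>2 = t * (1 - t)}"
    then show "q \<in> ?S" using stereo_surj_sphere by (cases q) blast
  qed
  have "closed {p :: 'a \<times> real. (norm (fst p))\<^sup>2 = snd p * (1 - snd p)}"
    by (intro closed_Collect_eq continuous_intros)
  then have "closed ?S" by (simp add: S case_prod_unfold)
  moreover have "bounded ?S"
  proof -
    have "dist (stereo Infty) (stereo p) \<le> 1" for p :: "'a ext"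
    proof (cases p)
      case (Fin x)
      have "1 \<le> sqrt (1 + (norm x)\<^sup>2)" by simp
      then show ?thesis
        using one_plus_norm_sq_pos[of x]
        by (simp add: Fin dist_stereo dist_ext_def divide_le_eq_1 del: stereo.simps)
    qed simp
    then show ?thesis unfolding bounded_def by blast
  qed
  ultimately have "compact ?S" by (simp add: compact_eq_bounded_closed)
  moreover have "continuous_on ?S (inv stereo)"
  proof -
    have "inv stereo (stereo p) = p" for p :: "'a ext"
      by (simp add: inj_def inj_stereo inv_f_f)
    then show ?thesis unfolding continuous_on_iff by (auto simp: dist_stereo)
  qed
  ultimately have "compact (inv stereo ` ?S)" by (rule compact_continuous_image[rotated])
  moreover have "inv stereo ` ?S = (UNIV :: 'a ext set)"
    by (simp add: image_image inj_def inj_stereo inv_f_f)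
  ultimately show ?thesis by simp
qed

lemma ext_convergent_subseq:
  fixes p :: "nat \<Rightarrow> 'a::euclidean_space ext"
  obtains l r where "strict_mono r" "(p \<circ> r) \<longlonglongrightarrow> l"
  using compact_UNIV_ext unfolding compact_eq_seq_compact_metric seq_compact_def by blast

text \<open>Completeness of the target is what the extension of a uniformly continuous map to the
  closure requires.\<close>

instance ext :: (euclidean_space) complete_space
proof
  fix X :: "nat \<Rightarrow> 'a ext" assume "Cauchy X"
  then show "convergent X"
    using compact_imp_complete[OF compact_UNIV_ext] unfolding complete_def convergent_def by auto
qed

lemma frontier_Fin_image:
  assumes "open D"
  shows "frontier (Fin ` D) = closure (Fin ` D) - Fin ` D"
  by (simp add: assms frontier_def interior_open open_Fin_image)

subsection \<open>Length and line integrals along subcurves\<close>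

definition polygon_length :: "(real \<Rightarrow> 'a::metric_space) \<Rightarrow> real list \<Rightarrow> ennreal" where
  "polygon_length \<gamma> ts = (\<Sum>i<length ts - 1. ennreal (dist (\<gamma> (ts ! i)) (\<gamma> (ts ! Suc i))))"

lemma curve_length_polygon:
  "curve_length (a, b, \<gamma>) = (SUP ts \<in> {ts. sorted ts \<and> set ts \<subseteq> {a..b}}. polygon_length \<gamma> ts)"
  by (simp add: curve_length_def polygon_length_def)

lemma polygon_length_le_curve_length:
  "sorted ts \<Longrightarrow> set ts \<subseteq> {a..b} \<Longrightarrow> polygon_length \<gamma> ts \<le> curve_length (a, b, \<gamma>)"
  unfolding curve_length_polygon by (rule SUP_upper) simp

lemma curve_length_leI:
  assumes "\<And>ts. sorted ts \<Longrightarrow> set ts \<subseteq> {a..b} \<Longrightarrow> polygon_length \<gamma> ts \<le> l"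
  shows "curve_length (a, b, \<gamma>) \<le> l"
  unfolding curve_length_polygon by (rule SUP_least) (use assms in auto)

lemma polygon_length_map: "polygon_length \<gamma> (map h ts) = polygon_length (\<gamma> \<circ> h) ts"
  by (auto simp: polygon_length_def intro!: sum.cong)

lemma polygon_length_Nil: "polygon_length \<gamma> [] = 0"
  and polygon_length_single: "polygon_length \<gamma> [x] = 0"
  and polygon_length_Cons:
    "polygon_length \<gamma> (x # y # ts) = ennreal (dist (\<gamma> x) (\<gamma> y)) + polygon_length \<gamma> (y # ts)"
  unfolding polygon_length_def by (simp_all add: sum.lessThan_Suc_shift del: sum.lessThan_Suc)

text \<open>Only an inequality: joining the lists adds the edge from the last node of
  \<open>ts\<close> to the first node of \<open>us\<close>.\<close>

lemma polygon_length_append: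
  "polygon_length \<gamma> ts + polygon_length \<gamma> us \<le> polygon_length \<gamma> (ts @ us)"
proof (induction \<gamma> ts rule: induct_list012[where P = "\<lambda>ts. polygon_length \<gamma> ts + polygon_length \<gamma> us \<le> polygon_length \<gamma> (ts @ us)" for \<gamma>])
  case 1
  then show ?case by (simp add: polygon_length_Nil)
next
  case (2 x)
  then show ?case
    by (cases us) (simp_all add: polygon_length_Nil polygon_length_single polygon_length_Cons)
next
  case (3 x y ts)
  then show ?case
    by (simp add: polygon_length_Cons add.assoc add_left_mono)
qed

lemma curve_length_mono:
  "a \<le> c \<Longrightarrow> d \<le> b \<Longrightarrow> curve_length (c, d, \<gamma>) \<le> curve_length (a, b, \<gamma>)"
  by (rule curve_length_leI, rule polygon_length_le_curve_length) fastforce+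

lemma dist_le_curve_length:
  "a \<le> b \<Longrightarrow> ennreal (dist (\<gamma> a) (\<gamma> b)) \<le> curve_length (a, b, \<gamma>)"
  using polygon_length_le_curve_length[of "[a, b]" a b \<gamma>]
  by (simp add: polygon_length_Cons polygon_length_single)

lemma curve_length_triv: "b \<le> a \<Longrightarrow> curve_length (a, b, \<gamma>) = 0"
proof -
  assume "b \<le> a"
  then have "set ts \<subseteq> {a} " if "set ts \<subseteq> {a..b}" for ts using that by fastforce
  then have "polygon_length \<gamma> ts = 0" if "set ts \<subseteq> {a..b}" for ts
    using that unfolding polygon_length_def
    by (intro sum.neutral ballI)
      (metis (no_types, lifting) Suc_lessD dist_self ennreal_0 lessThan_iff less_diff_conv nth_mem plus_1_eq_Suc add.commute singletonD subsetD)
  then have "curve_length (a, b, \<gamma>) \<le> 0" by (intro curve_length_leI) simp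
  then show ?thesis by simp
qed

lemma sorted_map_min_max:
  fixes ts :: "real list"
  assumes "sorted ts"
  shows "sorted (map (\<lambda>x. min x c) ts)" and "sorted (map (\<lambda>x. max x c) ts)"
  using assms by (induction ts) (auto intro: min.coboundedI1 max.coboundedI1)

text \<open>Truncating a partition at \<open>c\<close> from above and from below splits each edge,
  by the triangle inequality through \<open>\<gamma> c\<close>; conversely, partitions of the two
  halves concatenate.\<close>

lemma curve_length_add:
  assumes "a \<le> c" "c \<le> b"
  shows "curve_length (a, b, \<gamma>) = curve_length (a, c, \<gamma>) + curve_length (c, b, \<gamma>)"
proof (rule antisym)
  show "curve_length (a, b, \<gamma>) \<le> curve_length (a, c, \<gamma>) + curve_length (c, b, \<gamma>)"
  proof (rule curve_length_leI)
    fix ts assume ts: "sorted ts" "set ts \<subseteq> {a..b}"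
    have key: "ennreal (dist (\<gamma> x) (\<gamma> y))
        \<le> ennreal (dist (\<gamma> (min x c)) (\<gamma> (min y c))) + ennreal (dist (\<gamma> (max x c)) (\<gamma> (max y c)))"
      if "x \<le> y" for x y
      using that dist_triangle[of "\<gamma> x" "\<gamma> y" "\<gamma> c"]
      by (cases "x \<le> c"; cases "y \<le> c")
        (auto simp: min_def max_def simp flip: ennreal_plus intro!: ennreal_leI)
    have "polygon_length \<gamma> ts
        \<le> polygon_length \<gamma> (map (\<lambda>x. min x c) ts) + polygon_length \<gamma> (map (\<lambda>x. max x c) ts)"
      unfolding polygon_length_map unfolding polygon_length_def sum.distrib[symmetric]
      using ts by (intro sum_mono) (auto intro!: key simp: sorted_iff_nth_mono)
    also have "\<dots> \<le> curve_length (a, c, \<gamma>) + curve_length (c, b, \<gamma>)"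
    proof (intro add_mono polygon_length_le_curve_length)
      show "sorted (map (\<lambda>x. min x c) ts)" "sorted (map (\<lambda>x. max x c) ts)"
        using ts(1) by (auto intro!: sorted_map_min_max)
      show "set (map (\<lambda>x. min x c) ts) \<subseteq> {a..c}" "set (map (\<lambda>x. max x c) ts) \<subseteq> {c..b}"
        using ts(2) assms by auto
    qed
    finally show "polygon_length \<gamma> ts \<le> curve_length (a, c, \<gamma>) + curve_length (c, b, \<gamma>)" .
  qed
  let ?P = "\<lambda>a b. {ts. sorted ts \<and> set ts \<subseteq> {a..b}}"
  have ne: "?P a c \<noteq> {}" "?P c b \<noteq> {}" by (auto intro: exI[of _ "[]"])
  have "polygon_length \<gamma> ts + polygon_length \<gamma> us \<le> curve_length (a, b, \<gamma>)"
    if "ts \<in> ?P a c" "us \<in> ?P c b" for ts us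
  proof -
    have "sorted (ts @ us)" "set (ts @ us) \<subseteq> {a..b}"
      using that assms by (fastforce simp: sorted_append)+
    then show ?thesis
      using polygon_length_append polygon_length_le_curve_length order_trans by blast
  qed
  then show "curve_length (a, c, \<gamma>) + curve_length (c, b, \<gamma>) \<le> curve_length (a, b, \<gamma>)"
    unfolding curve_length_polygon[of a c] curve_length_polygon[of c b]
      ennreal_SUP_add_left[OF ne(1), symmetric] ennreal_SUP_add_right[OF ne(2)]
    by (intro SUP_least)
qed

text \<open>Lower semicontinuity of length in an endpoint: for a list of nodes the polygon length
  depends continuously on the nodes, and length is a supremum of such functions.\<close>

lemma closed_curve_length_le:
  assumes "continuous_on {a..b} \<gamma>" "a \<le> b"
  shows "closed {t \<in> {a..b}. curve_length (a, t, \<gamma>) \<le> s}"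
    and "closed {t \<in> {a..b}. curve_length (t, b, \<gamma>) \<le> s}"
proof -
  let ?P = "{ts. sorted ts \<and> set ts \<subseteq> {a..b}}"
  let ?L = "\<lambda>h t. \<lambda>ts. polygon_length \<gamma> (map (\<lambda>x. h x t) ts)"
  have cl: "closed {t \<in> {a..b}. ?L h t ts \<le> s}"
    if ts: "ts \<in> ?P" and h: "\<And>x. continuous_on {a..b} (h x)" "\<And>x t. x \<in> {a..b} \<Longrightarrow> t \<in> {a..b} \<Longrightarrow> h x t \<in> {a..b}"
    for ts and h :: "real \<Rightarrow> real \<Rightarrow> real"
  proof -
    have "continuous_on {a..b} (\<lambda>t. \<gamma> (h (ts ! i) t))" if "i < length ts" for i
    proof (rule continuous_on_compose2[OF assms(1) h(1)])
      show "h (ts ! i) ` {a..b} \<subseteq> {a..b}"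
        using h(2) ts nth_mem[OF that] by blast
    qed
    then have "continuous_on {a..b} (\<lambda>t. ?L h t ts)"
      unfolding polygon_length_map unfolding polygon_length_def
      by (subst sum_ennreal) (auto intro!: continuous_on_sum continuous_on_ennreal continuous_on_dist)
    then have "closed ({a..b} \<inter> (\<lambda>t. ?L h t ts) -` {..s})"
      by (rule continuous_closed_preimage) auto
    moreover have "{a..b} \<inter> (\<lambda>t. ?L h t ts) -` {..s} = {t \<in> {a..b}. ?L h t ts \<le> s}"
      by auto
    ultimately show ?thesis by simp
  qed
  \<comment> \<open>Clamping the nodes by \<open>min x t\<close> replaces the lists in
    \<open>[a, t]\<close>, which vary with \<open>t\<close>, by the fixed index set
    \<open>?P\<close>; the sublevel set becomes an intersection of closed sets.\<close>
  have "{t \<in> {a..b}. curve_length (a, t, \<gamma>) \<le> s} = (\<Inter>ts\<in>?P. {t \<in> {a..b}. ?L min t ts \<le> s})"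
  proof (intro set_eqI iffI)
    fix t assume t: "t \<in> {t \<in> {a..b}. curve_length (a, t, \<gamma>) \<le> s}"
    have "?L min t ts \<le> curve_length (a, t, \<gamma>)" if "ts \<in> ?P" for ts
      using that t by (intro polygon_length_le_curve_length)
        (auto intro!: sorted_map_min_max)
    then show "t \<in> (\<Inter>ts\<in>?P. {t \<in> {a..b}. ?L min t ts \<le> s})"
      using t order_trans by blast
  next
    fix t assume t: "t \<in> (\<Inter>ts\<in>?P. {t \<in> {a..b}. ?L min t ts \<le> s})"
    then have tb: "t \<in> {a..b}" by (auto dest!: spec[where x = "[]"])
    have "curve_length (a, t, \<gamma>) \<le> s"
    proof (rule curve_length_leI)
      fix ts assume ts: "sorted ts" "set ts \<subseteq> {a..t}"
      then have "map (\<lambda>x. min x t) ts = ts" by (intro map_idI) (auto simp: min_def)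
      moreover have "ts \<in> ?P" using ts tb by auto
      ultimately show "polygon_length \<gamma> ts \<le> s" using t by force
    qed
    then show "t \<in> {t \<in> {a..b}. curve_length (a, t, \<gamma>) \<le> s}" using tb by simp
  qed
  also have "closed \<dots>"
    by (intro closed_INT ballI cl) (auto intro!: continuous_intros)
  finally show "closed {t \<in> {a..b}. curve_length (a, t, \<gamma>) \<le> s}" .
  have "{t \<in> {a..b}. curve_length (t, b, \<gamma>) \<le> s} = (\<Inter>ts\<in>?P. {t \<in> {a..b}. ?L max t ts \<le> s})"
  proof (intro set_eqI iffI)
    fix t assume t: "t \<in> {t \<in> {a..b}. curve_length (t, b, \<gamma>) \<le> s}"
    have "?L max t ts \<le> curve_length (t, b, \<gamma>)" if "ts \<in> ?P" for ts
      using that t by (intro polygon_length_le_curve_length)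
        (auto intro!: sorted_map_min_max)
    then show "t \<in> (\<Inter>ts\<in>?P. {t \<in> {a..b}. ?L max t ts \<le> s})"
      using t order_trans by blast
  next
    fix t assume t: "t \<in> (\<Inter>ts\<in>?P. {t \<in> {a..b}. ?L max t ts \<le> s})"
    then have tb: "t \<in> {a..b}" by (auto dest!: spec[where x = "[]"])
    have "curve_length (t, b, \<gamma>) \<le> s"
    proof (rule curve_length_leI)
      fix ts assume ts: "sorted ts" "set ts \<subseteq> {t..b}"
      then have "map (\<lambda>x. max x t) ts = ts" by (intro map_idI) (auto simp: max_def)
      moreover have "ts \<in> ?P" using ts tb by auto
      ultimately show "polygon_length \<gamma> ts \<le> s" using t by force
    qed
    then show "t \<in> {t \<in> {a..b}. curve_length (t, b, \<gamma>) \<le> s}" using tb by simp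
  qed
  also have "closed \<dots>"
    by (intro closed_INT ballI cl) (auto intro!: continuous_intros)
  finally show "closed {t \<in> {a..b}. curve_length (t, b, \<gamma>) \<le> s}" .
qed

lemma enn2real_curve_length:
  assumes "curve_length (a, b, \<gamma>) < \<infinity>" "a \<le> u" "v \<le> b"
  shows "ennreal (enn2real (curve_length (u, v, \<gamma>))) = curve_length (u, v, \<gamma>)"
  using curve_length_mono[OF assms(2,3), of \<gamma>] assms(1) by simp

lemma enn2real_curve_length_add:
  assumes "curve_length (a, b, \<gamma>) < \<infinity>" "a \<le> u" "u \<le> v" "v \<le> w" "w \<le> b"
  shows "enn2real (curve_length (u, w, \<gamma>))
    = enn2real (curve_length (u, v, \<gamma>)) + enn2real (curve_length (v, w, \<gamma>))"
proof -
  have "curve_length (u, v, \<gamma>) < \<infinity>" "curve_length (v, w, \<gamma>) < \<infinity>"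
    using assms curve_length_mono[of a u v b \<gamma>] curve_length_mono[of a v w b \<gamma>] by auto
  then show ?thesis
    using assms by (simp add: curve_length_add[of u v w] enn2real_plus)
qed

text \<open>Suprema of polygon lengths make \<open>curve_length (a, t, \<gamma>)\<close> and \<open>curve_length (t, b, \<gamma>)\<close> only lower
  semicontinuous in \<open>t\<close>; as their sum is constant, connectedness of \<open>[a, b]\<close> still gives an
  intermediate value property.\<close>

lemma curve_length_attains:
  assumes "continuous_on {a..b} \<gamma>" "a \<le> b" "curve_length (a, b, \<gamma>) < \<infinity>"
    and s: "0 \<le> s" "s \<le> enn2real (curve_length (a, b, \<gamma>))"
  obtains t where "t \<in> {a..b}" "curve_length (a, t, \<gamma>) = ennreal s"
proof -
  define l where "l u v = enn2real (curve_length (u, v, \<gamma>))" for u v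
  have l: "curve_length (u, v, \<gamma>) = ennreal (l u v)" if "a \<le> u" "v \<le> b" for u v
    unfolding l_def using enn2real_curve_length[OF assms(3) that] by simp
  have l0: "0 \<le> l u v" for u v by (simp add: l_def)
  have add: "l a b = l a t + l t b" if "t \<in> {a..b}" for t
    unfolding l_def using that by (intro enn2real_curve_length_add[OF assms(3)]) auto
  let ?A = "{t \<in> {a..b}. curve_length (a, t, \<gamma>) \<le> ennreal s}"
  let ?B = "{t \<in> {a..b}. curve_length (t, b, \<gamma>) \<le> ennreal (l a b - s)}"
  have sl: "s \<le> l a b" using s by (simp add: l_def)
  have "\<exists>t. t \<in> ?A \<inter> ?B"
  proof (rule ccontr)
    assume "\<nexists>t. t \<in> ?A \<inter> ?B"
    then have "?A \<inter> ?B \<inter> {a..b} = {}" by blast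
    moreover have "{a..b} \<subseteq> ?A \<union> ?B"
    proof
      fix t assume t: "t \<in> {a..b}"
      show "t \<in> ?A \<union> ?B"
      proof (cases "l a t \<le> s")
        case True
        then show ?thesis using t by (simp add: l ennreal_leI)
      next
        case False
        then have "l t b \<le> l a b - s" using add[OF t] by simp
        then show ?thesis using t by (simp add: l ennreal_leI)
      qed
    qed
    moreover have "a \<in> ?A" "b \<in> ?B" using assms(2) by (auto simp: curve_length_triv)
    ultimately have "closed ?A \<and> closed ?B \<and> {a..b} \<subseteq> ?A \<union> ?B \<and> ?A \<inter> ?B \<inter> {a..b} = {}
        \<and> ?A \<inter> {a..b} \<noteq> {} \<and> ?B \<inter> {a..b} \<noteq> {}"
      using closed_curve_length_le[OF assms(1,2)] by blast
    then show False
      using connected_Icc[of a b] unfolding connected_closed by blast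
  qed
  then obtain t where t: "t \<in> {a..b}" "l a t \<le> s" "l t b \<le> l a b - s"
    using s(1) sl by (auto simp: l)
  then have "l a t = s" using add by fastforce
  then show thesis using that t l by force
qed

text \<open>Two parameters with the same value of the length function bound a subcurve of length
  zero, so \<open>\<gamma>\<close> agrees at them and the choice made by \<open>SOME\<close> is
  harmless.\<close>

lemma arc_length_param_eq:
  assumes "curve_length (a, b, \<gamma>) < \<infinity>" "t \<in> {a..b}" "curve_length (a, t, \<gamma>) = ennreal s"
  shows "arc_length_param (a, b, \<gamma>) s = \<gamma> t"
proof -
  have eq: "\<gamma> u = \<gamma> v" if uv: "u \<in> {a..b}" "v \<in> {a..b}" "u \<le> v"
    "curve_length (a, u, \<gamma>) = curve_length (a, v, \<gamma>)" for u v
  proof -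
    have "enn2real (curve_length (u, v, \<gamma>)) = 0"
      using enn2real_curve_length_add[OF assms(1), of a u v] uv by auto
    then have "curve_length (u, v, \<gamma>) = 0"
      using enn2real_curve_length[OF assms(1), of u v] uv by auto
    then show ?thesis
      using dist_le_curve_length[OF uv(3), of \<gamma>] by (simp add: ennreal_eq_0_iff)
  qed
  let ?t = "SOME t. t \<in> {a..b} \<and> curve_length (a, t, \<gamma>) = ennreal s"
  have "?t \<in> {a..b} \<and> curve_length (a, ?t, \<gamma>) = ennreal s"
    by (rule someI_ex) (use assms in blast)
  then have "\<gamma> ?t = \<gamma> t"
    using eq[of ?t t] eq[of t ?t] assms by (metis linear)
  then show ?thesis by (simp add: arc_length_param_def)
qed

text \<open>The parametrization is 1-Lipschitz: two values are no farther apart than the length of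
  the curve between them, which is the difference of the parameters.\<close>

lemma continuous_on_arc_length_param:
  assumes "continuous_on {a..b} \<gamma>" "a \<le> b" "curve_length (a, b, \<gamma>) < \<infinity>"
  shows "continuous_on {0..enn2real (curve_length (a, b, \<gamma>))} (arc_length_param (a, b, \<gamma>))"
proof -
  let ?I = "{0..enn2real (curve_length (a, b, \<gamma>))}" and ?\<alpha> = "arc_length_param (a, b, \<gamma>)"
  have le: "dist (?\<alpha> s) (?\<alpha> r) \<le> r - s" if "s \<in> ?I" "r \<in> ?I" "s < r" for s r
  proof -
    obtain t where t: "t \<in> {a..b}" "curve_length (a, t, \<gamma>) = ennreal s"
      using curve_length_attains[OF assms] \<open>s \<in> ?I\<close> by (metis atLeastAtMost_iff)
    obtain u where u: "u \<in> {a..b}" "curve_length (a, u, \<gamma>) = ennreal r"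
      using curve_length_attains[OF assms] \<open>r \<in> ?I\<close> by (metis atLeastAtMost_iff)
    have "t \<le> u"
      using curve_length_mono[of a a u t \<gamma>] t u that by (fastforce simp: not_le[symmetric])
    then have "ennreal (dist (\<gamma> t) (\<gamma> u)) \<le> curve_length (t, u, \<gamma>)"
      by (rule dist_le_curve_length)
    also have "\<dots> = ennreal (enn2real (curve_length (t, u, \<gamma>)))"
      using enn2real_curve_length[OF assms(3), of t u] t u by simp
    also have "enn2real (curve_length (t, u, \<gamma>)) = r - s"
      using enn2real_curve_length_add[OF assms(3), of a t u] t u \<open>t \<le> u\<close> that by auto
    finally show ?thesis
      using arc_length_param_eq[OF assms(3)] t u that by simp
  qed
  have "dist (?\<alpha> s) (?\<alpha> r) \<le> dist s r" if "s \<in> ?I" "r \<in> ?I" for s r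
    using le[OF that] le[OF that(2,1)]
    by (cases s r rule: linorder_cases) (auto simp: dist_real_def dist_commute)
  then show ?thesis
    unfolding continuous_on_iff by (meson order_le_less_trans)
qed

text \<open>Up to a shift by the length of the initial piece, the subcurve has the arc length
  parametrization of the whole curve, so its integral runs over a subinterval.\<close>

lemma line_integral_subcurve_le:
  assumes "continuous_on {a..b} \<gamma>" "curve_length (a, b, \<gamma>) < \<infinity>"
    and "a \<le> c" "c \<le> d" "d \<le> b"
    and \<rho>: "\<rho> \<in> borel_measurable borel"
  shows "line_integral \<rho> (c, d, \<gamma>) \<le> line_integral \<rho> (a, b, \<gamma>)"
proof -
  let ?l = "\<lambda>u v. enn2real (curve_length (u, v, \<gamma>))"
  let ?\<alpha> = "arc_length_param (a, b, \<gamma>)"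
  have fin: "curve_length (c, d, \<gamma>) < \<infinity>"
    using assms curve_length_mono[of a c d b \<gamma>] by auto
  have add: "?l a b = ?l a c + ?l c d + ?l d b"
    using enn2real_curve_length_add[OF assms(2), of a c b] enn2real_curve_length_add[OF assms(2), of c d b] assms
    by simp
  \<comment> \<open>Extended by zero, the integrand is Borel on the whole line, as the translation
    rule for the integral demands.\<close>
  define h where "h s = \<rho> (?\<alpha> s) * indicator {0..?l a b} s" for s
  have "?\<alpha> \<in> borel_measurable (restrict_space borel {0..?l a b})"
    using assms by (intro borel_measurable_continuous_on_restrict continuous_on_arc_length_param) auto
  then have "(\<lambda>s. \<rho> (?\<alpha> s)) \<in> borel_measurable (restrict_space borel {0..?l a b})"
    using \<rho> by (rule measurable_compose)
  then have h: "h \<in> borel_measurable borel"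
    unfolding h_def by (subst (asm) borel_measurable_restrict_space_iff_ennreal) auto
  have shift: "arc_length_param (c, d, \<gamma>) s = ?\<alpha> (?l a c + s)" if s: "s \<in> {0..?l c d}" for s
  proof -
    obtain t where t: "t \<in> {c..d}" "curve_length (c, t, \<gamma>) = ennreal s"
      using curve_length_attains[of c d \<gamma> s] assms fin s
      by (metis atLeastAtMost_iff atLeastatMost_subset_iff continuous_on_subset)
    have "curve_length (a, t, \<gamma>) = ennreal (?l a c + s)"
      using t s assms enn2real_curve_length[OF assms(2), of a c]
      by (simp add: curve_length_add[of a c t] ennreal_plus)
    then show ?thesis
      using arc_length_param_eq[OF fin t] arc_length_param_eq[OF assms(2), of t] t assms by auto
  qed
  have "line_integral \<rho> (c, d, \<gamma>) \<le> (\<integral>\<^sup>+ s. h (?l a c + 1 * s) \<partial>lborel)"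
    unfolding line_integral_def
  proof (rule nn_integral_mono)
    fix s
    show "\<rho> (arc_length_param (c, d, \<gamma>) s) * indicator {0..?l c d} s \<le> h (?l a c + 1 * s)"
    proof (cases "s \<in> {0..?l c d}")
      case True
      then have "?l a c + s \<in> {0..?l a b}" using add by (simp add: add_increasing2)
      then show ?thesis using True by (simp add: h_def shift)
    qed simp
  qed
  also have "\<dots> = (\<integral>\<^sup>+ s. h s \<partial>lborel)"
    using nn_integral_real_affine[OF h, of 1 "?l a c"] by simp
  finally show ?thesis by (simp add: line_integral_def h_def)
qed

section \<open>Comparison and finiteness of moduli\<close>

text \<open>Minorization: a density admissible for the pieces is admissible for the longer curves,
  since rectifiability passes to pieces and line integrals only grow.\<close>

lemma modulus_le_of_subcurves:
  assumes "\<And>a b \<gamma>. (a, b, \<gamma>) \<in> \<Gamma> \<Longrightarrow>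
    is_curve (a, b, \<gamma>) \<and> (\<exists>c d. a \<le> c \<and> c \<le> d \<and> d \<le> b \<and> (c, d, \<gamma>) \<in> \<Delta>)"
  shows "modulus \<Gamma> \<le> modulus \<Delta>"
  unfolding modulus_def
proof (rule INF_superset_mono)
  show "{\<rho>. admissible \<rho> \<Delta>} \<subseteq> {\<rho>. admissible \<rho> \<Gamma>}"
  proof clarify
    fix \<rho> :: "'a \<Rightarrow> ennreal" assume adm: "admissible \<rho> \<Delta>"
    have "1 \<le> line_integral \<rho> (a, b, \<gamma>)"
      if in\<Gamma>: "(a, b, \<gamma>) \<in> \<Gamma>" and rect: "locally_rectifiable (a, b, \<gamma>)" for a b \<gamma>
    proof -
      obtain c d where cd: "a \<le> c" "c \<le> d" "d \<le> b" "(c, d, \<gamma>) \<in> \<Delta>"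
        using assms[OF in\<Gamma>] by blast
      have cont: "continuous_on {a..b} \<gamma>" and "a < b"
        using assms[OF in\<Gamma>] by (auto simp: is_curve_def)
      have "locally_rectifiable (c, d, \<gamma>)"
        using rect cd by (auto simp: locally_rectifiable_def)
      then have "1 \<le> line_integral \<rho> (c, d, \<gamma>)"
        using adm cd(4) by (auto simp: admissible_def)
      also have "\<dots> \<le> line_integral \<rho> (a, b, \<gamma>)"
      proof (rule line_integral_subcurve_le[OF cont _ cd(1-3)])
        show "curve_length (a, b, \<gamma>) < \<infinity>"
          using rect \<open>a < b\<close> by (auto simp: locally_rectifiable_def)
        show "\<rho> \<in> borel_measurable borel" using adm by (simp add: admissible_def)
      qed
      finally show ?thesis .
    qed
    then show "admissible \<rho> \<Gamma>" using adm by (auto simp: admissible_def)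
  qed
qed simp

text \<open>Take \<open>d\<close> as the first time at level \<open>r2\<close> or above, then
  \<open>c\<close> as the last time before \<open>d\<close> at level \<open>r1\<close> or
  below.\<close>

lemma crossing_subinterval:
  fixes u :: "real \<Rightarrow> real"
  assumes "continuous_on {a..b} u" "a \<le> b" "u a \<le> r1" "r1 < r2" "r2 \<le> u b"
  obtains c d where "a \<le> c" "c < d" "d \<le> b" "u c = r1" "u d = r2"
    "\<And>t. c < t \<Longrightarrow> t < d \<Longrightarrow> r1 < u t \<and> u t < r2"
proof -
  have "compact ({a..b} \<inter> u -` {r2..})"
    by (simp add: assms(1) compact_eq_bounded_closed continuous_closed_preimage bounded_Int)
  moreover have "b \<in> {a..b} \<inter> u -` {r2..}" using assms by auto
  ultimately obtain d where d: "d \<in> {a..b}" "r2 \<le> u d"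
    and dmin: "\<And>t. t \<in> {a..b} \<Longrightarrow> r2 \<le> u t \<Longrightarrow> d \<le> t"
    using compact_attains_inf[of "{a..b} \<inter> u -` {r2..}"] by blast
  have cont_d: "continuous_on {a..d} u"
    using assms(1) d(1) by (auto intro: continuous_on_subset)
  have "compact ({a..d} \<inter> u -` {..r1})"
    by (simp add: cont_d compact_eq_bounded_closed continuous_closed_preimage bounded_Int)
  moreover have "a \<in> {a..d} \<inter> u -` {..r1}" using assms d by auto
  ultimately obtain c where c: "c \<in> {a..d}" "u c \<le> r1"
    and cmax: "\<And>t. t \<in> {a..d} \<Longrightarrow> u t \<le> r1 \<Longrightarrow> t \<le> c"
    using compact_attains_sup[of "{a..d} \<inter> u -` {..r1}"] by blast
  have cd: "c < d"
    using c d assms(4) by (cases "c = d") auto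
  have cont_cd: "continuous_on {c..d} u"
    using cont_d c(1) by (auto intro: continuous_on_subset)
  \<comment> \<open>The intermediate value theorem gives a time in \<open>[c, d]\<close> at level
    \<open>r2\<close>, which is \<open>d\<close> by minimality; symmetrically for
    \<open>c\<close>.\<close>
  have ud: "u d = r2"
    using IVT'[of u c r2 d] c d cd cont_cd assms(4) dmin
    by (metis antisym_conv atLeastAtMost_iff less_imp_le order_refl order_trans)
  have uc: "u c = r1"
    using IVT'[of u c r1 d] c d cd cont_cd assms(4) cmax
    by (metis antisym_conv atLeastAtMost_iff less_imp_le order_refl order_trans)
  have "r1 < u t \<and> u t < r2" if "c < t" "t < d" for t
    using that c d cmax[of t] dmin[of t] by (auto simp: not_le[symmetric])
  then show thesis using that c d cd ud uc by auto
qed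

text \<open>Along a path from \<open>C1\<close> to \<open>C2\<close> the image crosses the ring
  between the two spheres; the crossing piece belongs to the lifted family, so minorization
  applies.\<close>

lemma modulus_connecting_le_lifted:
  assumes "continuous_on D f" "C1 \<subseteq> D" "C2 \<subseteq> D" "r1 < r2"
    and "\<And>x. x \<in> C1 \<Longrightarrow> dist (f x) y0 \<le> r1"
    and "\<And>x. x \<in> C2 \<Longrightarrow> r2 \<le> dist (f x) y0"
  shows "modulus (connecting_curves C1 C2 D) \<le> modulus (lifted_curves f D y0 r1 r2)"
proof (rule modulus_le_of_subcurves)
  fix a b \<gamma> assume "(a, b, \<gamma>) \<in> connecting_curves C1 C2 D"
  then have curve: "is_curve (a, b, \<gamma>)" and ends: "\<gamma> a \<in> C1" "\<gamma> b \<in> C2"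
    and inner: "\<forall>t\<in>{a<..<b}. \<gamma> t \<in> D"
    by (auto simp: connecting_curves_def)
  have ab: "a < b" and cont: "continuous_on {a..b} \<gamma>"
    using curve by (auto simp: is_curve_def)
  have \<gamma>D: "\<gamma> ` {a..b} \<subseteq> D"
  proof (intro image_subsetI)
    fix t assume "t \<in> {a..b}"
    then show "\<gamma> t \<in> D"
      using inner ends assms(2,3) by (cases "t = a"; cases "t = b") auto
  qed
  have cont_f: "continuous_on {a..b} (f \<circ> \<gamma>)"
    using cont \<gamma>D assms(1) continuous_on_compose continuous_on_subset by blast
  then have "continuous_on {a..b} (\<lambda>t. dist ((f \<circ> \<gamma>) t) y0)"
    by (rule continuous_on_dist[OF _ continuous_on_const])
  then obtain c d where cd: "a \<le> c" "c < d" "d \<le> b"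
    "dist ((f \<circ> \<gamma>) c) y0 = r1" "dist ((f \<circ> \<gamma>) d) y0 = r2"
    "\<And>t. c < t \<Longrightarrow> t < d \<Longrightarrow> r1 < dist ((f \<circ> \<gamma>) t) y0 \<and> dist ((f \<circ> \<gamma>) t) y0 < r2"
    using crossing_subinterval[of a b "\<lambda>t. dist ((f \<circ> \<gamma>) t) y0" r1 r2] ab ends assms(4-6) by auto
  have sub: "{c..d} \<subseteq> {a..b}" using cd by auto
  have "(c, d, \<gamma>) \<in> lifted_curves f D y0 r1 r2"
    using cd \<gamma>D sub continuous_on_subset[OF cont sub] continuous_on_subset[OF cont_f sub]
    by (auto simp: lifted_curves_def connecting_curves_def is_curve_def annulus_def dist_commute)
  then show "is_curve (a, b, \<gamma>) \<and>
      (\<exists>c d. a \<le> c \<and> c \<le> d \<and> d \<le> b \<and> (c, d, \<gamma>) \<in> lifted_curves f D y0 r1 r2)"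
    using curve cd by (meson less_imp_le)
qed

text \<open>The constant weight \<open>1 / (r2 - r1)\<close> has integral one and bounds the modulus
  by a finite multiple of the integral of \<open>Q\<close>. The point \<open>x\<close> certifies
  that \<open>r2\<close> lies below the required supremum.\<close>

lemma inverse_poletsky_modulus_finite:
  fixes f :: "'a::euclidean_space \<Rightarrow> 'a"
  assumes pol: "inverse_poletsky f D Q y0" and r: "0 < r1" "r1 < r2"
    and x: "x \<in> D" "r2 < dist (f x) y0"
    and Q: "Q \<in> borel_measurable lebesgue" "(\<integral>\<^sup>+ y \<in> f ` D. Q y \<partial>lebesgue) < \<infinity>"
    and meas: "f ` D \<in> sets lebesgue"
  shows "modulus (lifted_curves f D y0 r1 r2) < \<infinity>"
proof -
  define k where "k = ennreal (1 / (r2 - r1))"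
  have "ereal r2 < (SUP y\<in>f ` D. ereal (dist y y0))"
    using x by (auto simp: less_SUP_iff)
  moreover have "1 \<le> (\<integral>\<^sup>+ r \<in> {r1<..<r2}. k \<partial>lebesgue)"
    using r by (simp add: k_def nn_integral_cmult_indicator flip: ennreal_mult)
  ultimately have "modulus (lifted_curves f D y0 r1 r2)
      \<le> (\<integral>\<^sup>+ y \<in> annulus y0 r1 r2 \<inter> f ` D. Q y * k ^ DIM('a) \<partial>lebesgue)"
    using pol[unfolded inverse_poletsky_def, rule_format, of r1 r2 "\<lambda>_. k"] r by simp
  also have "\<dots> \<le> (\<integral>\<^sup>+ y. k ^ DIM('a) * (Q y * indicator (f ` D) y) \<partial>lebesgue)"
    by (intro nn_integral_mono) (auto simp: indicator_def mult.commute)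
  also have "\<dots> = k ^ DIM('a) * (\<integral>\<^sup>+ y \<in> f ` D. Q y \<partial>lebesgue)"
    using Q meas by (intro nn_integral_cmult) simp
  also have "\<dots> < \<infinity>"
    using Q(2) by (simp add: k_def ennreal_mult_less_top power_less_top_ennreal)
  finally show ?thesis .
qed

subsection \<open>Lifting continua through an open map\<close>

text \<open>Properness of \<open>f\<close> off its boundary cluster set: a sequence in the preimage
  accumulates in the extended space, and an accumulation point on the boundary would put a point of
  \<open>K\<close> into that set.\<close>

lemma compact_preimage_off_boundary_cluster:
  fixes f :: "'a::euclidean_space \<Rightarrow> 'a"
  assumes "open D" "continuous_on D f" "compact K"
    and off: "\<And>y. y \<in> K \<Longrightarrow> Fin y \<notin> boundary_cluster_set f D"
  shows "compact {x \<in> D. f x \<in> K}"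
  unfolding compact_eq_seq_compact_metric seq_compact_def
proof (intro allI impI)
  fix u :: "nat \<Rightarrow> 'a" assume u: "\<forall>n. u n \<in> {x \<in> D. f x \<in> K}"
  \<comment> \<open>Compactness of the extended space also covers sequences escaping to
    infinity.\<close>
  obtain r p where r: "strict_mono r" "((\<lambda>k. Fin (u k)) \<circ> r) \<longlonglongrightarrow> p"
    by (rule ext_convergent_subseq)
  have "\<forall>n. ((f \<circ> u) \<circ> r) n \<in> K" using u by simp
  then obtain s y where s: "y \<in> K" "strict_mono s" "(((f \<circ> u) \<circ> r) \<circ> s) \<longlonglongrightarrow> y"
    using assms(3) unfolding compact_eq_seq_compact_metric seq_compact_def by metis
  define v where "v = u \<circ> (r \<circ> s)"
  have v: "v k \<in> D" for k using u by (simp add: v_def)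
  have vp: "(\<lambda>k. Fin (v k)) \<longlonglongrightarrow> p"
    using LIMSEQ_subseq_LIMSEQ[OF r(2) s(2)] by (simp add: v_def o_def)
  have fv: "(\<lambda>k. f (v k)) \<longlonglongrightarrow> y"
    using s(3) by (simp add: v_def o_def)
  have "p \<in> closure (Fin ` D)"
    unfolding closure_sequential
    by (rule exI[of _ "\<lambda>k. Fin (v k)"]) (use v vp in auto)
  moreover have "p \<notin> frontier (Fin ` D)"
  proof
    assume "p \<in> frontier (Fin ` D)"
    moreover have "Fin y \<in> cluster_set f D p"
      unfolding cluster_set_def mem_Collect_eq
      by (rule exI[of _ v]) (use v vp fv in \<open>simp add: tendsto_Fin_iff\<close>)
    ultimately show False using off[OF s(1)] by (auto simp: boundary_cluster_set_def)
  qed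
  ultimately obtain x where x: "x \<in> D" "p = Fin x"
    using frontier_Fin_image[OF assms(1)] by blast
  then have vx: "v \<longlonglongrightarrow> x" using vp by (simp add: tendsto_Fin_iff)
  have "(\<lambda>k. f (v k)) \<longlonglongrightarrow> f x"
    using continuous_on_tendsto_compose[OF assms(2) vx x(1)] v by simp
  then have "f x = y" using LIMSEQ_unique[OF _ fv] by simp
  then show "\<exists>l\<in>{x \<in> D. f x \<in> K}. \<exists>r. strict_mono r \<and> (u \<circ> r) \<longlonglongrightarrow> l"
    using x(1) s(1) vx strict_mono_o[OF r(1) s(2)] unfolding v_def by blast
qed

text \<open>Whyburn: a relatively clopen part of the compact preimage has an image clopen in \<open>K\<close>, and
  components of compact sets are intersections of clopen sets.  This replaces path lifting.\<close>

lemma component_of_preimage_onto: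
  fixes f :: "'a::euclidean_space \<Rightarrow> 'a"
  assumes "open D" "continuous_on D f" "open_map_on D f"
    and "connected K" "compact {x \<in> D. f x \<in> K}"
    and x: "x \<in> D" "f x \<in> K" and y: "y \<in> K"
  shows "\<exists>z \<in> connected_component_set {x \<in> D. f x \<in> K} x. f z = y"
proof (rule ccontr)
  let ?P = "{x \<in> D. f x \<in> K}"
  let ?C = "connected_component_set ?P x"
  assume none: "\<not> (\<exists>z \<in> ?C. f z = y)"
  have contP: "continuous_on ?P f" using assms(2) by (rule continuous_on_subset) auto
  have C: "?C \<in> components ?P" using x by (auto simp: components_def)
  have "closed {z \<in> ?P. f z = y}"
    using contP compact_imp_closed[OF assms(5)] by (rule continuous_closed_preimage_constant)
  moreover have "?C \<subseteq> - {z \<in> ?P. f z = y}" using none by blast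
  moreover have "locally compact ?P"
    by (rule closed_imp_locally_compact[OF compact_imp_closed[OF assms(5)]])
  \<comment> \<open>If the component misses the closed fibre over \<open>y\<close>, so does some
    compact set \<open>N\<close> that contains it and is open in the preimage.\<close>
  ultimately obtain N where N: "openin (top_of_set ?P) N" "compact N" "?C \<subseteq> N"
    "N \<subseteq> - {z \<in> ?P. f z = y}"
    using Sura_Bura_clopen_subset[OF _ C compact_components[OF assms(5) C] open_Compl] by blast
  obtain W where W: "open W" "N = ?P \<inter> W" using N(1) by (auto simp: openin_open)
  have "f ` N = K \<inter> f ` (W \<inter> D)" using W(2) by auto
  moreover have "open (f ` (W \<inter> D))"
    using assms(1,3) W(1) by (simp add: open_map_on_def open_Int)
  ultimately have "openin (top_of_set K) (f ` N)" by (auto simp: openin_open)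
  moreover have "closedin (top_of_set K) (f ` N)"
  proof (rule closed_subset)
    show "f ` N \<subseteq> K" using W(2) by auto
    have "continuous_on N f" by (rule continuous_on_subset[OF contP]) (use W(2) in blast)
    then show "closed (f ` N)" by (rule compact_imp_closed[OF compact_continuous_image[OF _ N(2)]])
  qed
  moreover have "f ` N \<noteq> {}" using N(3) x connected_component_refl[of x ?P] by blast
  ultimately have "f ` N = K"
    using assms(4) unfolding connected_clopen by blast
  then obtain z where "z \<in> N" "f z = y" using y by blast
  then show False using N(4) W(2) by blast
qed

text \<open>A path from \<open>f x\<close> to \<open>y\<close> over \<open>U\<close> and off
  \<open>E\<close> has compact preimage; the component of \<open>x\<close> in it reaches the fibre
  over \<open>y\<close> and is the required continuum.\<close>

lemma continuum_lift:
  fixes f :: "'a::euclidean_space \<Rightarrow> 'a"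
  assumes "open D" "continuous_on D f" "open_map_on D f"
    and E: "closed E" "boundary_cluster_set f D \<subseteq> E" and U: "open U"
    and x: "x \<in> D"
    and conn: "connected_component (U \<inter> (Fin ` f ` D - E)) (Fin (f x)) (Fin y)"
  obtains C z where "continuum C" "C \<subseteq> D" "x \<in> C" "z \<in> C" "f z = y" "Fin ` f ` C \<subseteq> U"
proof -
  let ?W = "U \<inter> (Fin ` f ` D - E)"
  \<comment> \<open>Pulled back to the finite space this is an open Euclidean set, where connected
    and path components coincide.\<close>
  define V where "V = Fin -` ?W"
  have "open (f ` D)" using assms(1,3) by (simp add: open_map_on_def)
  then have "open ?W" using E(1) U by (intro open_Int open_Diff open_Fin_image)
  then have "open V"
    unfolding V_def using continuous_on_Fin[of UNIV] open_vimage by blast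
  obtain T where T: "connected T" "T \<subseteq> ?W" "Fin (f x) \<in> T" "Fin y \<in> T"
    using conn by (auto simp: connected_component_def)
  have "T \<subseteq> range Fin" using T(2) by blast
  then have "connected (ext_fin ` T)"
    using T(1) continuous_on_ext_fin connected_continuous_image continuous_on_subset by blast
  moreover have "ext_fin ` T \<subseteq> V"
  proof clarify
    fix p assume "p \<in> T"
    moreover from this obtain y where "p = Fin y" using T(2) by blast
    ultimately show "ext_fin p \<in> V" using T(2) by (auto simp: V_def)
  qed
  moreover have "f x \<in> ext_fin ` T" "y \<in> ext_fin ` T"
    using T(3,4) ext_fin_Fin by (metis image_eqI)+
  ultimately have "connected_component V (f x) y"
    by (auto simp: connected_component_def)
  then have "path_component V (f x) y"
    using \<open>open V\<close> by (simp add: open_path_connected_component)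
  then obtain g where g: "path g" "path_image g \<subseteq> V" "pathstart g = f x" "pathfinish g = y"
    by (auto simp: path_component_def)
  let ?P = "{x \<in> D. f x \<in> path_image g}"
  let ?C = "connected_component_set ?P x"
  have P: "compact ?P"
  proof (rule compact_preimage_off_boundary_cluster[OF assms(1,2)])
    show "compact (path_image g)" using g(1) by (rule compact_path_image)
    show "Fin y \<notin> boundary_cluster_set f D" if "y \<in> path_image g" for y
      using that g(2) E(2) by (auto simp: V_def)
  qed
  have ends: "f x \<in> path_image g" "y \<in> path_image g"
    using pathstart_in_path_image[of g] pathfinish_in_path_image[of g] g(3,4) by simp_all
  have xC: "x \<in> ?C" using x ends(1) by (simp add: connected_component_refl)
  have "?C \<in> components ?P" using x ends by (auto simp: components_def)
  then have "continuum ?C"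
    unfolding continuum_def using P compact_components in_components_connected in_components_nonempty
    by blast
  moreover have CP: "?C \<subseteq> ?P" by (rule connected_component_subset)
  moreover obtain z where "z \<in> ?C" "f z = y"
    using component_of_preimage_onto[OF assms(1-3) connected_path_image[OF g(1)] P x ends] by blast
  moreover have "Fin ` f ` ?C \<subseteq> U" using CP g(2) by (auto simp: V_def)
  ultimately show thesis using that xC by blast
qed

text \<open>Pigeonhole on the finitely many components near \<open>z\<close>. As \<open>V\<close>
  need not be open, the conclusion is stated with the open \<open>U\<close>, to which
  \<open>continuum_lift\<close> applies.\<close>

lemma infinitely_many_in_component:
  assumes "locally_finitely_connected_wrt D E" "z \<in> E" "open U" "z \<in> U"
    and p: "\<And>k::nat. p k \<in> Fin ` D - E" "p \<longlonglongrightarrow> z"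
  obtains k0 where "infinite {k. connected_component (U \<inter> (Fin ` D - E)) (p k0) (p k)}"
proof -
  have "nbhd z U" using assms(3,4) by (simp add: nbhd_def interior_open)
  then obtain V where V: "V \<subseteq> U" "nbhd z V" "finite (components (V \<inter> (Fin ` D - E)))"
    using assms(1,2) unfolding locally_finitely_connected_wrt_def by blast
  let ?S = "V \<inter> (Fin ` D - E)"
  let ?A = "{k. p k \<in> V}"
  have "\<forall>\<^sub>F k in sequentially. p k \<in> interior V"
    using p(2) V(2) by (auto simp: nbhd_def intro: topological_tendstoD)
  then have "\<forall>\<^sub>F k in sequentially. p k \<in> V"
    by (rule eventually_mono) (use interior_subset in blast)
  then have "infinite ?A"
    by (simp add: eventually_sequentially infinite_nat_iff_unbounded_le) (meson linear)
  moreover have "finite ((\<lambda>k. connected_component_set ?S (p k)) ` ?A)"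
    by (rule finite_subset[OF _ V(3)]) (use p(1) in \<open>auto simp: components_def\<close>)
  ultimately obtain k0 where k0: "k0 \<in> ?A"
    "infinite {k \<in> ?A. connected_component_set ?S (p k) = connected_component_set ?S (p k0)}"
    using pigeonhole_infinite by blast
  moreover have "{k \<in> ?A. connected_component_set ?S (p k) = connected_component_set ?S (p k0)}
      \<subseteq> {k. connected_component (U \<inter> (Fin ` D - E)) (p k0) (p k)}"
  proof clarify
    fix k assume k: "p k \<in> V" "connected_component_set ?S (p k) = connected_component_set ?S (p k0)"
    then have "connected_component ?S (p k) (p k)"
      using p(1) by (simp add: connected_component_refl)
    then have "connected_component ?S (p k0) (p k)"
      using k(2) by (metis mem_Collect_eq)
    then show "connected_component (U \<inter> (Fin ` D - E)) (p k0) (p k)"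
      by (rule connected_component_of_subset) (use V(1) in blast)
  qed
  ultimately show thesis using that infinite_super by blast
qed

subsection \<open>Uniqueness of boundary values\<close>

text \<open>One limit is finite, so that spheres centred at it are available; the other may be
  \<open>Infty\<close>. Distinct limits give continua with images on either side of a ring about
  \<open>y0\<close>, whose modulus would be both bounded and too large.\<close>

lemma cluster_value_unique_finite:
  fixes f :: "'a::euclidean_space \<Rightarrow> 'a"
  assumes D: "open D" and cont: "continuous_on D f" and opn: "open_map_on D f"
    and x0: "x0 \<in> frontier (Fin ` D)" and flat: "weakly_flat_at D x0"
    and Q: "Q \<in> borel_measurable lebesgue" "(\<integral>\<^sup>+ y \<in> f ` D. Q y \<partial>lebesgue) < \<infinity>"
    and pol: "inverse_poletsky f D Q y0"
    and E: "closed E" "boundary_cluster_set f D \<subseteq> E" "locally_finitely_connected_wrt (f ` D) E"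
    and u: "\<And>k. u k \<in> D" "\<And>k. Fin (f (u k)) \<notin> E"
      "(\<lambda>k. Fin (u k)) \<longlonglongrightarrow> x0" "(\<lambda>k. Fin (f (u k))) \<longlonglongrightarrow> Fin y0"
    and v: "\<And>k. v k \<in> D" "\<And>k. Fin (f (v k)) \<notin> E"
      "(\<lambda>k. Fin (v k)) \<longlonglongrightarrow> x0" "(\<lambda>k. Fin (f (v k))) \<longlonglongrightarrow> z"
  shows "z = Fin y0"
proof (rule ccontr)
  assume neq: "z \<noteq> Fin y0"
  \<comment> \<open>Half the distance works for a finite \<open>z\<close>, any radius for
    \<open>Infty\<close>.\<close>
  obtain r where r: "0 < r" "z \<notin> Fin ` cball y0 r"
  proof (cases z)
    case (Fin w)
    then have "0 < dist y0 w" using neq by auto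
    moreover from this have "w \<notin> cball y0 (dist y0 w / 2)" unfolding mem_cball by linarith
    ultimately show thesis using that[of "dist y0 w / 2"] Fin half_gt_zero by blast
  next
    case Infty
    then show thesis using that[of 1] by auto
  qed
  \<comment> \<open>The images of the two continua will lie in \<open>U1\<close> and
    \<open>U2\<close>, on the two sides of the ring with radii \<open>r / 2\<close> and
    \<open>r\<close>.\<close>
  define U1 where "U1 = Fin ` ball y0 (r / 2)"
  define U2 where "U2 = - Fin ` cball y0 r"
  have "closed (Fin ` cball y0 r)"
    by (intro compact_imp_closed compact_continuous_image continuous_on_Fin compact_cball)
  then have U2: "open U2" "z \<in> U2" using r(2) by (auto simp: U2_def)
  have U1: "open U1" "Fin y0 \<in> U1" using r(1) by (auto simp: U1_def open_Fin_image)
  have "Fin y0 \<in> cluster_set f D x0" "z \<in> cluster_set f D x0"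
    using u(1,3,4) v(1,3,4) unfolding cluster_set_def by blast+
  then have "Fin y0 \<in> E" "z \<in> E"
    using E(2) x0 unfolding boundary_cluster_set_def by blast+
  let ?W = "\<lambda>U. U \<inter> (Fin ` f ` D - E)"
  obtain i where i: "infinite {k. connected_component (?W U1) (Fin (f (u i))) (Fin (f (u k)))}"
    using infinitely_many_in_component[OF E(3) \<open>Fin y0 \<in> E\<close> U1 _ u(4)] u(1,2) by blast
  obtain j where j: "infinite {k. connected_component (?W U2) (Fin (f (v j))) (Fin (f (v k)))}"
    using infinitely_many_in_component[OF E(3) \<open>z \<in> E\<close> U2 _ v(4)] v(1,2) by blast
  \<comment> \<open>The fibres over two base values: every lifted continuum ends in this set, which
    is compact because the base values avoid \<open>E\<close>.\<close>
  define A where "A = {x \<in> D. f x \<in> {f (u i), f (v j)}}"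
  have "compact A"
    unfolding A_def
    using u(2)[of i] v(2)[of j] E(2) by (intro compact_preimage_off_boundary_cluster[OF D cont]) auto
  then have "closed (Fin ` A)"
    by (intro compact_imp_closed compact_continuous_image continuous_on_Fin)
  moreover have "x0 \<notin> Fin ` A"
    using x0 frontier_Fin_image[OF D] by (auto simp: A_def)
  \<comment> \<open>The complement of these fibres serves as the outer neighbourhood in weak
    flatness.\<close>
  ultimately have nbhd: "nbhd x0 (- Fin ` A)"
    by (simp add: nbhd_def interior_open open_Compl)
  let ?M = "modulus (lifted_curves f D y0 (r / 2) r)"
  \<comment> \<open>The added 1 keeps the threshold positive; \<open>enn2real\<close> sends an
    infinite value to 0, so finiteness of \<open>?M\<close> may be shown later.\<close>
  obtain V where V: "V \<subseteq> - Fin ` A" "nbhd x0 V"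
    and big: "\<And>C1 C2. continuum C1 \<and> continuum C2 \<and> C1 \<subseteq> D \<and> C2 \<subseteq> D \<and>
        Fin ` C1 \<inter> frontier (- Fin ` A) \<noteq> {} \<and> Fin ` C1 \<inter> frontier V \<noteq> {} \<and>
        Fin ` C2 \<inter> frontier (- Fin ` A) \<noteq> {} \<and> Fin ` C2 \<inter> frontier V \<noteq> {} \<Longrightarrow>
        ennreal (enn2real ?M + 1) < modulus (connecting_curves C1 C2 D)"
  proof -
    have "0 < enn2real ?M + 1" by (simp add: add_nonneg_pos)
    then show thesis
      using flat nbhd that unfolding weakly_flat_at_def by meson
  qed
  have continuum_through:
    "\<exists>C k. continuum C \<and> C \<subseteq> D \<and> w k \<in> C \<and> Fin ` f ` C \<subseteq> U
      \<and> Fin ` C \<inter> frontier (- Fin ` A) \<noteq> {} \<and> Fin ` C \<inter> frontier V \<noteq> {}"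
    if w: "\<And>k. w k \<in> D" "(\<lambda>k. Fin (w k)) \<longlonglongrightarrow> x0" and U: "open U"
      and inf: "infinite {k. connected_component (?W U) (Fin (f (w m))) (Fin (f (w k)))}"
      and A: "f (w m) \<in> {f (u i), f (v j)}"
    for w U m
  proof -
    have "\<forall>\<^sub>F k in sequentially. Fin (w k) \<in> interior V"
      using w(2) V(2) by (auto simp: nbhd_def intro: topological_tendstoD)
    then obtain N where "\<And>k. N \<le> k \<Longrightarrow> Fin (w k) \<in> interior V"
      by (auto simp: eventually_sequentially)
    \<comment> \<open>Infinitely many terms share the component, so one of them is late enough to
      lie in \<open>V\<close>.\<close>
    then obtain k where k: "Fin (w k) \<in> V"
      "connected_component (?W U) (Fin (f (w m))) (Fin (f (w k)))"
      using inf interior_subset unfolding infinite_nat_iff_unbounded_le by blast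
    obtain C y where C: "continuum C" "C \<subseteq> D" "w k \<in> C" "y \<in> C" "f y = f (w m)"
      "Fin ` f ` C \<subseteq> U"
      using continuum_lift[OF D cont opn E(1,2) U w(1) connected_component_sym[OF k(2)]] by blast
    have "connected (Fin ` C)"
      using C(1) by (auto simp: continuum_def intro: connected_continuous_image continuous_on_Fin)
    moreover have "Fin y \<in> Fin ` A" using C A by (auto simp: A_def)
    \<comment> \<open>The continuum contains \<open>w k\<close>, inside both neighbourhoods, and
      \<open>y\<close> in \<open>A\<close>, outside both; being connected it crosses both
      frontiers.\<close>
    ultimately have "Fin ` C \<inter> frontier (- Fin ` A) \<noteq> {}" "Fin ` C \<inter> frontier V \<noteq> {}"
      using V(1) k(1) C(3,4) by (intro connected_Int_frontier; blast)+
    then show ?thesis using C by blast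
  qed
  obtain C1 where C1: "continuum C1" "C1 \<subseteq> D" "Fin ` f ` C1 \<subseteq> U1"
    "Fin ` C1 \<inter> frontier (- Fin ` A) \<noteq> {}" "Fin ` C1 \<inter> frontier V \<noteq> {}"
    using continuum_through[OF u(1,3) U1(1) i] by blast
  obtain C2 k where C2: "continuum C2" "C2 \<subseteq> D" "v k \<in> C2" "Fin ` f ` C2 \<subseteq> U2"
    "Fin ` C2 \<inter> frontier (- Fin ` A) \<noteq> {}" "Fin ` C2 \<inter> frontier V \<noteq> {}"
    using continuum_through[OF v(1,3) U2(1) j] by blast
  have near: "dist (f x) y0 \<le> r / 2" if "x \<in> C1" for x
    using C1(3) that by (force simp: U1_def dist_commute)
  have far: "r < dist (f x) y0" if "x \<in> C2" for x
    using C2(4) that by (force simp: U2_def dist_commute)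
  have "modulus (connecting_curves C1 C2 D) \<le> ?M"
    using near far r(1) less_imp_le by (intro modulus_connecting_le_lifted[OF cont C1(2) C2(2)]) auto
  \<comment> \<open>The term \<open>v k\<close> of \<open>C2\<close>, with image farther than
    \<open>r\<close> from \<open>y0\<close>, makes the radius \<open>r\<close> admissible.\<close>
  moreover have "?M < \<infinity>"
  proof (rule inverse_poletsky_modulus_finite[OF pol _ _ v(1) far[OF C2(3)] Q])
    have "open (f ` D)" using D opn by (simp add: open_map_on_def)
    then show "f ` D \<in> sets lebesgue" by simp
  qed (use r in auto)
  moreover have "ennreal (enn2real ?M + 1) < modulus (connecting_curves C1 C2 D)"
    using big C1 C2 by blast
  ultimately have "ennreal (enn2real ?M + 1) < ennreal (enn2real ?M)"
    by (metis ennreal_enn2real infinity_ennreal_def order_less_le_trans)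
  then show False by (simp add: ennreal_less_iff)
qed

text \<open>By continuity the points close to \<open>x\<close> with image close to
  \<open>f x\<close> form a nonempty set open in \<open>D\<close>, which the nowhere dense preimage
  of \<open>E\<close> cannot contain.\<close>

lemma dense_off_nowhere_dense_preimage:
  fixes f :: "'a::real_inner \<Rightarrow> 'a"
  assumes "open D" "continuous_on D f" "nowhere_dense_in D {x \<in> D. Fin (f x) \<in> E \<inter> Fin ` f ` D}"
    and "x \<in> D" "0 < e"
  obtains y where "y \<in> D" "Fin (f y) \<notin> E" "dist (Fin y) (Fin x) < e"
    "dist (Fin (f y)) (Fin (f x)) < e"
proof -
  let ?A = "{x \<in> D. Fin (f x) \<in> E \<inter> Fin ` f ` D}"
  let ?W = "(D \<inter> f -` ball (f x) e) \<inter> ball x e"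
  have "open ?W"
    using assms(1,2) by (intro open_Int open_ball continuous_open_preimage)
  then have W: "openin (top_of_set D) ?W" by (auto simp: openin_open)
  have "x \<in> ?W" using assms(4,5) by simp
  have "\<not> ?W \<subseteq> ?A"
  proof
    assume "?W \<subseteq> ?A"
    also have "\<dots> \<subseteq> (top_of_set D) closure_of ?A" by (rule closure_of_subset) auto
    finally have "?W \<subseteq> {}"
      using W interior_of_maximal assms(3) unfolding nowhere_dense_in_def by metis
    then show False using \<open>x \<in> ?W\<close> by blast
  qed
  then obtain y where "y \<in> ?W" "y \<notin> ?A" by blast
  then show thesis
    using that[of y] dist_Fin_le[of y x] dist_Fin_le[of "f y" "f x"] by (auto simp: dist_commute)
qed

subsection \<open>The extension\<close>

theorem corollary1p1:
  fixes D D' :: "(real ^ 'n) set"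
    and f :: "real ^ 'n \<Rightarrow> real ^ 'n"
    and Q :: "real ^ 'n \<Rightarrow> ennreal"
    and E :: "(real ^ 'n) ext set"
  assumes dim: "CARD('n) \<ge> 2"
    and dom: "domain D" "domain D'"
    and flat: "weakly_flat_boundary D"
    and Q_meas: "Q \<in> borel_measurable lebesgue"
    and Q_int: "(\<integral>\<^sup>+ y \<in> D'. Q y \<partial>lebesgue) < \<infinity>"
    and f_cont: "continuous_on D f"
    and f_open: "open_map_on D f"
    and f_discrete: "discrete_map_on D f"
    and f_onto: "f ` D = D'"
    and f_poletsky: "\<And>y0. Fin y0 \<in> closure (Fin ` D') \<Longrightarrow> inverse_poletsky f D Q y0"
    and E_cluster: "boundary_cluster_set f D \<subseteq> E"
    and E_sub: "E \<subseteq> closure (Fin ` D')"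
    and E_closed: "closed E"
    and E_lfc: "locally_finitely_connected_wrt D' E"
    and E_preimage: "nowhere_dense_in D {x \<in> D. Fin (f x) \<in> E \<inter> Fin ` D'}"
  shows "\<exists>g :: (real ^ 'n) ext \<Rightarrow> (real ^ 'n) ext.
           continuous_on (closure (Fin ` D)) g \<and>
           (\<forall>x\<in>D. g (Fin x) = Fin (f x)) \<and>
           g ` closure (Fin ` D) = closure (Fin ` D')"
proof -
  have D: "open D" using dom(1) by (simp add: domain_def)
  have finite_limit: "z = Fin y0"
    if "x0 \<in> frontier (Fin ` D)"
      "\<And>k. u k \<in> D \<and> Fin (f (u k)) \<notin> E" "\<And>k. v k \<in> D \<and> Fin (f (v k)) \<notin> E"
      "(\<lambda>k. Fin (u k)) \<longlonglongrightarrow> x0" "(\<lambda>k. Fin (v k)) \<longlonglongrightarrow> x0"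
      "(\<lambda>k. Fin (f (u k))) \<longlonglongrightarrow> Fin y0" "(\<lambda>k. Fin (f (v k))) \<longlonglongrightarrow> z"
    for x0 y0 z and u v :: "nat \<Rightarrow> real ^ 'n"
  proof (rule cluster_value_unique_finite[OF D f_cont f_open that(1) _ Q_meas _ _ E_closed E_cluster])
    show "weakly_flat_at D x0" using flat that(1) by (simp add: weakly_flat_boundary_def)
    \<comment> \<open>As a limit of image points, \<open>y0\<close> lies in the closure of
      \<open>D'\<close>, where the inverse Poletsky inequality is assumed.\<close>
    have "Fin y0 \<in> closure (Fin ` D')"
      unfolding closure_sequential using that(2,6) f_onto
      by (auto intro!: exI[of _ "\<lambda>k. Fin (f (u k))"])
    then show "inverse_poletsky f D Q y0" by (rule f_poletsky)
  qed (use that Q_int E_lfc f_onto in auto)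
  \<comment> \<open>One of two distinct limits is finite; the sequences are exchanged if it is the
    second.\<close>
  have limit_unique: "z1 = z2"
    if "x0 \<in> frontier (Fin ` D)"
      "\<And>k. u k \<in> D \<and> Fin (f (u k)) \<notin> E" "\<And>k. v k \<in> D \<and> Fin (f (v k)) \<notin> E"
      "(\<lambda>k. Fin (u k)) \<longlonglongrightarrow> x0" "(\<lambda>k. Fin (v k)) \<longlonglongrightarrow> x0"
      "(\<lambda>k. Fin (f (u k))) \<longlonglongrightarrow> z1" "(\<lambda>k. Fin (f (v k))) \<longlonglongrightarrow> z2"
    for x0 z1 z2 and u v :: "nat \<Rightarrow> real ^ 'n"
    using finite_limit[OF that(1-5)] finite_limit[OF that(1,3,2,5,4)] that(6,7)
    by (cases z1; cases z2) auto

  \<comment> \<open>Uniform continuity for the chordal metric\<close>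
  define F where "F = (\<lambda>p. Fin (f (ext_fin p)))"
  have "uniformly_continuous_on (Fin ` D) F"
  proof (rule ccontr)
    assume "\<not> ?thesis"
    then have "\<exists>e>0. \<forall>d>0. \<exists>x\<in>D. \<exists>y\<in>D.
        dist (Fin y) (Fin x) < d \<and> e \<le> dist (Fin (f y)) (Fin (f x))"
      by (simp add: uniformly_continuous_on_def F_def not_less) (meson not_less)
    then obtain e where e: "0 < e" and bad: "\<And>d. 0 < d \<Longrightarrow> \<exists>x\<in>D. \<exists>y\<in>D.
        dist (Fin y) (Fin x) < d \<and> e \<le> dist (Fin (f y)) (Fin (f x))"
      by metis
    have "\<exists>a b. (a \<in> D \<and> Fin (f a) \<notin> E) \<and> (b \<in> D \<and> Fin (f b) \<notin> E)
        \<and> dist (Fin a) (Fin b) \<le> 3 / real (Suc k) \<and> e / 2 \<le> dist (Fin (f a)) (Fin (f b))" for k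
    proof -
      \<comment> \<open>Moving both points off the preimage of \<open>E\<close> costs at most
        \<open>e / 4\<close> twice in the image, leaving \<open>e / 2\<close>; in the domain three
        distances below \<open>d\<close> add up.\<close>
      define d where "d = min (1 / real (Suc k)) (e / 4)"
      have d: "0 < d" "d \<le> 1 / real (Suc k)" "d \<le> e / 4" using e by (auto simp: d_def)
      obtain x y where xy: "x \<in> D" "y \<in> D" "dist (Fin y) (Fin x) < d"
        "e \<le> dist (Fin (f y)) (Fin (f x))"
        using bad[OF d(1)] by blast
      obtain a where a: "a \<in> D" "Fin (f a) \<notin> E" "dist (Fin a) (Fin x) < d"
        "dist (Fin (f a)) (Fin (f x)) < d"
        using dense_off_nowhere_dense_preimage[OF D f_cont _ xy(1) d(1)] E_preimage f_onto by blast
      obtain b where b: "b \<in> D" "Fin (f b) \<notin> E" "dist (Fin b) (Fin y) < d"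
        "dist (Fin (f b)) (Fin (f y)) < d"
        using dense_off_nowhere_dense_preimage[OF D f_cont _ xy(2) d(1)] E_preimage f_onto by blast
      have tri: "dist p q \<le> dist p r + dist q s + dist s r" for p q r s :: "(real ^ 'n) ext"
        using dist_triangle[of p q r] dist_triangle[of r q s]
        by (simp add: dist_commute)
      have "dist (Fin a) (Fin b) \<le> 3 * (1 / real (Suc k))"
        using tri[of "Fin a" "Fin b" "Fin x" "Fin y"] a b xy d by linarith
      moreover have "e / 2 \<le> dist (Fin (f a)) (Fin (f b))"
        using tri[of "Fin (f y)" "Fin (f x)" "Fin (f b)" "Fin (f a)"] a b xy d
        by (simp add: dist_commute)
      ultimately show ?thesis using a b by auto
    qed
    then obtain a b where a: "\<And>k. a k \<in> D \<and> Fin (f (a k)) \<notin> E"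
      and b: "\<And>k. b k \<in> D \<and> Fin (f (b k)) \<notin> E"
      and ab: "\<And>k. dist (Fin (a k)) (Fin (b k)) \<le> 3 / real (Suc k)"
      and far: "\<And>k. e / 2 \<le> dist (Fin (f (a k))) (Fin (f (b k)))"
      by metis
    \<comment> \<open>Three nested subsequences make the first points and then both image sequences
      converge.\<close>
    obtain r1 p where r1: "strict_mono r1" "((\<lambda>k. Fin (a k)) \<circ> r1) \<longlonglongrightarrow> p"
      by (rule ext_convergent_subseq)
    obtain r2 z1 where r2: "strict_mono r2" "((\<lambda>k. Fin (f (a (r1 k)))) \<circ> r2) \<longlonglongrightarrow> z1"
      by (rule ext_convergent_subseq)
    obtain r3 z2 where r3: "strict_mono r3" "((\<lambda>k. Fin (f (b (r1 (r2 k))))) \<circ> r3) \<longlonglongrightarrow> z2"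
      by (rule ext_convergent_subseq)
    define r where "r = r1 \<circ> r2 \<circ> r3"
    have r: "strict_mono r" using r1(1) r2(1) r3(1) by (simp add: r_def strict_mono_o)
    have ap: "(\<lambda>k. Fin (a (r k))) \<longlonglongrightarrow> p"
      using LIMSEQ_subseq_LIMSEQ[OF r1(2) strict_mono_o[OF r2(1) r3(1)]] by (simp add: r_def o_def)
    have "(\<lambda>k. 3 / real (Suc k)) \<longlonglongrightarrow> 0"
      using tendsto_mult_right_zero[OF LIMSEQ_Suc[OF lim_inverse_n'], of 3] by (simp add: divide_inverse)
    then have "(\<lambda>k. dist (Fin (a k)) (Fin (b k))) \<longlonglongrightarrow> 0"
      by (rule Lim_null_comparison[rotated]) (use ab in simp)
    then have "(\<lambda>k. dist (Fin (a (r k))) (Fin (b (r k)))) \<longlonglongrightarrow> 0"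
      using LIMSEQ_subseq_LIMSEQ[OF _ r] by (fastforce simp: o_def)
    then have bp: "(\<lambda>k. Fin (b (r k))) \<longlonglongrightarrow> p"
    proof -
      assume "(\<lambda>k. dist (Fin (a (r k))) (Fin (b (r k)))) \<longlonglongrightarrow> 0"
      then have "(\<lambda>k. dist (Fin (a (r k))) (Fin (b (r k))) + dist (Fin (a (r k))) p) \<longlonglongrightarrow> 0"
        by (rule tendsto_add_zero) (use ap in \<open>simp flip: tendsto_dist_iff\<close>)
      then have "(\<lambda>k. dist (Fin (b (r k))) p) \<longlonglongrightarrow> 0"
        by (rule Lim_null_comparison[rotated]) (simp add: dist_triangle3)
      then show ?thesis by (rule iffD2[OF tendsto_dist_iff])
    qed
    have z1: "(\<lambda>k. Fin (f (a (r k)))) \<longlonglongrightarrow> z1"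
      using LIMSEQ_subseq_LIMSEQ[OF r2(2) r3(1)] by (simp add: r_def o_def)
    have z2: "(\<lambda>k. Fin (f (b (r k)))) \<longlonglongrightarrow> z2"
      using r3(2) by (simp add: r_def o_def)
    have "e / 2 \<le> dist z1 z2"
      using LIMSEQ_le_const[OF tendsto_dist[OF z1 z2]] far by blast
    \<comment> \<open>On the boundary the limits agree by uniqueness; inside \<open>D\<close> both
      are the value of \<open>f\<close> at \<open>p\<close>, by continuity.\<close>
    moreover have "z1 = z2"
    proof (cases "p \<in> frontier (Fin ` D)")
      case True
      show ?thesis
        by (rule limit_unique[OF True _ _ ap bp z1 z2]) (use a b in auto)
    next
      case False
      have "p \<in> closure (Fin ` D)"
        unfolding closure_sequential
        by (rule exI[of _ "\<lambda>k. Fin (a (r k))"]) (use a ap in auto)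
      with False obtain x where x: "x \<in> D" "p = Fin x"
        using frontier_Fin_image[OF D] by blast
      have "(\<lambda>k. Fin (f (w (r k)))) \<longlonglongrightarrow> Fin (f x)"
        if "\<And>k. w k \<in> D" "(\<lambda>k. Fin (w (r k))) \<longlonglongrightarrow> p" for w
        unfolding tendsto_Fin_iff
        by (rule continuous_on_tendsto_compose[OF f_cont _ x(1)])
          (use that x(2) in \<open>simp_all add: tendsto_Fin_iff\<close>)
      from this[of a] this[of b] show ?thesis
        using a b ap bp LIMSEQ_unique[OF z1] LIMSEQ_unique[OF z2] by simp
    qed
    ultimately show False using e by simp
  qed

  \<comment> \<open>Extension to the closure and its image\<close>
  then obtain g where g: "uniformly_continuous_on (closure (Fin ` D)) g"
    "\<And>p. p \<in> Fin ` D \<Longrightarrow> F p = g p"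
    using uniformly_continuous_on_extension_on_closure by metis
  then have gc: "continuous_on (closure (Fin ` D)) g"
    by (simp add: uniformly_continuous_imp_continuous)
  have gf: "g (Fin x) = Fin (f x)" if "x \<in> D" for x
    using g(2)[of "Fin x"] that by (simp add: F_def)
  then have img: "g ` Fin ` D = Fin ` D'" using f_onto by force
  \<comment> \<open>The image of the compact closure of \<open>D\<close> is closed and contains
    \<open>D'\<close>, hence also the closure of \<open>D'\<close>.\<close>
  have "compact (closure (Fin ` D))"
    using compact_Int_closed[OF compact_UNIV_ext closed_closure] by simp
  then have "closed (g ` closure (Fin ` D))"
    using compact_imp_closed[OF compact_continuous_image[OF gc]] by blast
  moreover have "Fin ` D' \<subseteq> g ` closure (Fin ` D)"
    using image_mono[OF closure_subset[of "Fin ` D"], of g] img by simp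
  ultimately have "closure (Fin ` D') \<subseteq> g ` closure (Fin ` D)"
    by (rule closure_minimal[rotated])
  moreover have "g ` closure (Fin ` D) \<subseteq> closure (Fin ` D')"
    using continuous_image_closure_subset[OF gc order_refl] img by simp
  ultimately show ?thesis using gc gf by blast
qed

end
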